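(* Let $T,h_1\in(0,\infty)$, and consider exact HMC, or unadjusted numerical HMC with step size $h\in(0,h_1]$ such that $T/h\in\mathbb{Z}$, with transition kernel $\pi$. Suppose that (A1), (A2), (A4) and (A5) of the context are satisfied with $R_2=\infty$, that is, the drift inequality in (A5) holds for all $x\in\mathbb{R}^d$; let $\mathcal{R}=\sup\{|x|:x\in\mathbb{R}^d,\ \Psi(x)\le4\alpha/\lambda\}$, and suppose that $$L(T+h_1)^2\le\min\left(\frac14,\frac1{256\,L\mathcal{R}^2}\right).$$ Put $\gamma=\min(T^{-1},\mathcal{R}^{-1}/4)$, $a=T^{-1}$, $R_1=\frac52(\mathcal{R}+T)$, $\epsilon=\frac1{40\,\alpha}e^{-2\mathcal{R}/T}$, $f(r)=\int_0^r\exp(-a\min(s,R_1))\,ds$ and $$\rho_\epsilon(x,y)=\sqrt{f(\min(|x-y|,2\mathcal{R}))\cdot(1+\epsilon\Psi(x)+\epsilon\Psi(y))}.$$ Let $(X'(x,y),Y'(x,y))$ be the coupling of two transition steps described in the context (with this $\gamma$ and $\mathcal{R}$). Then for all $x,y\in\mathbb{R}^d$, $$E[\rho_\epsilon(X'(x,y),Y'(x,y))]\le(1-c)\,\rho_\epsilon(x,y),\qquad\text{where}\quad c=\frac1{80}\min\left(10\,\lambda,\ e^{-2\mathcal{R}/T}\right).$$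
   Context: Assumptions: $U\in C^4(\mathbb{R}^d)$ with $\int_{\mathbb{R}^d}e^{-U(x)}dx<\infty$, and (A1) $U$ has a local minimum at $0$ and $U(0)=0$; (A2) $U$ has bounded second, third and fourth derivatives; $L=\sup\|\nabla^2U\|$. Moreover, there exist a measurable function $\Psi:\mathbb{R}^d\to[0,\infty)$ and constants $\lambda,\alpha\in(0,\infty)$, $R_2\in(0,\infty]$ such that (A4) the level set $\{x\in\mathbb{R}^d:\Psi(x)\le4\alpha/\lambda\}$ is compact; (A5) $(\pi\Psi)(x)\le(1-\lambda)\Psi(x)+\alpha$ for all $x\in\mathbb{R}^d$ with $|x|<R_2$, where $(\pi\Psi)(x)=\int\Psi(y)\pi(x,dy)$. $|\cdot|$ is the Euclidean norm. If $\mathcal{R}=0$, then $1/\mathcal{R}$ and $1/\mathcal{R}^2$ are read as $+\infty$. Flows: for exact HMC, $(q_t(x,v),p_t(x,v))$ solves $\frac d{dt}q_t=p_t$, $\frac d{dt}p_t=-\nabla U(q_t)$, $(q_0,p_0)=(x,v)$. For unadjusted numerical HMC with step size $h>0$, with $\lfloor t\rfloor_h=\max\{s\in h\mathbb{Z}:s\le t\}$ and $\lceil t\rceil_h=\min\{s\in h\mathbb{Z}:s\ge t\}$, $(q_t,p_t)$ is the velocity Verlet flow, i.e. the solution of $$\tfrac{d}{dt}q_t=p_{\lfloor t\rfloor_h}-\tfrac h2\nabla U(q_{\lfloor t\rfloor_h}),\qquad \tfrac d{dt}p_t=-\tfrac12\big(\nabla U(q_{\lfloor t\rfloor_h})+\nabla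 U(q_{\lceil t\rceil_h})\big),\qquad (q_0,p_0)=(x,v).$$ In both cases the transition step is $X'(x)=q_T(x,\xi)$ with $\xi\sim N(0,I_d)$, and $\pi(x,B)=P[q_T(x,\xi)\in B]$. Coupling: let $\xi\sim N(0,I_d)$ and $\tilde{\mathcal{U}}\sim\mathrm{Unif}(0,1)$ be independent. Put $X'(x,y)=q_T(x,\xi)$, $Y'(x,y)=q_T(y,\eta)$, where - if $|x-y|\ge2\mathcal{R}$, $\eta=\xi$ (synchronous coupling); - if $|x-y|<2\mathcal{R}$, with $z=x-y$, $e=z/|z|$ and $\varphi_{0,1}$ the standard normal density on $\mathbb{R}$, $\eta=\xi+\gamma z$ if $\tilde{\mathcal{U}}\le\varphi_{0,1}(e\cdot\xi+\gamma|z|)/\varphi_{0,1}(e\cdot\xi)$, and $\eta=\xi-2(e\cdot\xi)e$ otherwise (for $z=0$ this gives $\eta=\xi$). *)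

theory Defs
  imports "HOL-Probability.Probability"
begin

text \<open>The space \<open>\<real>\<^sup>d\<close> is an arbitrary type of class \<^class>\<open>euclidean_space\<close>
  (so \<open>d = DIM('a) \<ge> 1\<close>).\<close>

definition fderiv ::
    "('a::real_normed_vector \<Rightarrow> 'b::real_normed_vector) \<Rightarrow> 'a \<Rightarrow> 'a \<Rightarrow>\<^sub>L 'b" where
  "fderiv f x = Blinfun (frechet_derivative f (at x))"

definition C1_map :: "('a::real_normed_vector \<Rightarrow> 'b::real_normed_vector) \<Rightarrow> bool" where
  "C1_map f \<longleftrightarrow> (\<forall>x. f differentiable (at x)) \<and> continuous_on UNIV (fderiv f)"

text \<open>The iterated derivatives \<open>fderiv (\<dots> (fderiv f))\<close> are curried multilinear maps; their norm is
  the operator norm. In particular the norm of the second derivative of a scalar function is the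
  operator norm of its Hessian.\<close>

definition C4_map :: "('a::real_normed_vector \<Rightarrow> 'b::real_normed_vector) \<Rightarrow> bool" where
  "C4_map f \<longleftrightarrow> C1_map f \<and> C1_map (fderiv f) \<and> C1_map (fderiv (fderiv f))
      \<and> C1_map (fderiv (fderiv (fderiv f)))"

definition grad :: "('a::real_inner \<Rightarrow> real) \<Rightarrow> 'a \<Rightarrow> 'a" where
  "grad U x = (THE D. GDERIV U x :> D)"

text \<open>The curves below are \<open>t \<mapsto> q t x v\<close> and \<open>t \<mapsto> p t x v\<close> for \<open>t \<ge> 0\<close>, with \<open>(x, v)\<close> the initial
  position and velocity.\<close>

definition exact_flow ::
    "('a::euclidean_space \<Rightarrow> real) \<Rightarrow> (real \<Rightarrow> 'a \<Rightarrow> 'a \<Rightarrow> 'a) \<Rightarrow> (real \<Rightarrow> 'a \<Rightarrow> 'a \<Rightarrow> 'a) \<Rightarrow> bool" where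
  "exact_flow U q p \<longleftrightarrow> (\<forall>x v. q 0 x v = x \<and> p 0 x v = v \<and>
     (\<forall>t\<ge>0. ((\<lambda>s. q s x v) has_vector_derivative p t x v) (at t within {0..}) \<and>
            ((\<lambda>s. p s x v) has_vector_derivative - grad U (q t x v)) (at t within {0..})))"

definition grid :: "real \<Rightarrow> real set" where
  "grid h = {h * of_int k | k :: int. True}"

definition grid_floor :: "real \<Rightarrow> real \<Rightarrow> real" where
  "grid_floor h t = (GREATEST s. s \<in> grid h \<and> s \<le> t)"

definition grid_ceiling :: "real \<Rightarrow> real \<Rightarrow> real" where
  "grid_ceiling h t = (LEAST s. s \<in> grid h \<and> t \<le> s)"

lemma grid_floor_eq:
  assumes "0 < h"
  shows "grid_floor h t = h * of_int \<lfloor>t / h\<rfloor>"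
  unfolding grid_floor_def
proof (rule Greatest_equality)
  show "h * of_int \<lfloor>t / h\<rfloor> \<in> grid h \<and> h * of_int \<lfloor>t / h\<rfloor> \<le> t"
    using of_int_floor_le[of "t / h"] pos_le_divide_eq[OF assms, of "of_int \<lfloor>t / h\<rfloor>" t]
    by (auto simp only: grid_def mult.commute)
next
  fix s assume "s \<in> grid h \<and> s \<le> t"
  then obtain k :: int where k: "s = h * of_int k" "h * of_int k \<le> t" by (auto simp: grid_def)
  then have "k \<le> \<lfloor>t / h\<rfloor>" using assms by (simp add: le_floor_iff field_simps)
  then show "s \<le> h * of_int \<lfloor>t / h\<rfloor>" using assms k by simp
qed

lemma grid_ceiling_eq:
  assumes "0 < h"
  shows "grid_ceiling h t = h * of_int \<lceil>t / h\<rceil>"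
  unfolding grid_ceiling_def
proof (rule Least_equality)
  show "h * of_int \<lceil>t / h\<rceil> \<in> grid h \<and> t \<le> h * of_int \<lceil>t / h\<rceil>"
    using le_of_int_ceiling[of "t / h"] pos_divide_le_eq[OF assms, of t "of_int \<lceil>t / h\<rceil>"]
    by (auto simp only: grid_def mult.commute)
next
  fix s assume "s \<in> grid h \<and> t \<le> s"
  then obtain k :: int where k: "s = h * of_int k" "t \<le> h * of_int k" by (auto simp: grid_def)
  then have "\<lceil>t / h\<rceil> \<le> k" using assms by (simp add: ceiling_le_iff field_simps)
  then show "h * of_int \<lceil>t / h\<rceil> \<le> s" using assms k by simp
qed

text \<open>The right-hand side of the Verlet equations is piecewise constant and jumps at the grid
  points, so a solution is a pair of continuous curves that satisfy the equations at all times
  off the grid.\<close>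

definition verlet_flow ::
    "('a::euclidean_space \<Rightarrow> real) \<Rightarrow> real \<Rightarrow> (real \<Rightarrow> 'a \<Rightarrow> 'a \<Rightarrow> 'a) \<Rightarrow> (real \<Rightarrow> 'a \<Rightarrow> 'a \<Rightarrow> 'a)
      \<Rightarrow> bool" where
  "verlet_flow U h q p \<longleftrightarrow> (\<forall>x v. q 0 x v = x \<and> p 0 x v = v \<and>
     continuous_on {0..} (\<lambda>s. q s x v) \<and> continuous_on {0..} (\<lambda>s. p s x v) \<and>
     (\<forall>t. 0 < t \<and> t \<notin> grid h \<longrightarrow>
        ((\<lambda>s. q s x v) has_vector_derivative
           p (grid_floor h t) x v - (h / 2) *\<^sub>R grad U (q (grid_floor h t) x v)) (at t) \<and>
        ((\<lambda>s. p s x v) has_vector_derivative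
           - (1 / 2) *\<^sub>R (grad U (q (grid_floor h t) x v) + grad U (q (grid_ceiling h t) x v)))
          (at t)))"

definition std_gaussian :: "'a::euclidean_space measure" where
  "std_gaussian =
     density lborel (\<lambda>x. ennreal (exp (- (norm x)\<^sup>2 / 2) / sqrt (2 * pi) ^ DIM('a)))"

definition hmc_kernel ::
    "(real \<Rightarrow> 'a \<Rightarrow> 'a \<Rightarrow> 'a::euclidean_space) \<Rightarrow> real \<Rightarrow> 'a \<Rightarrow> 'a measure" where
  "hmc_kernel q T x = distr std_gaussian borel (\<lambda>\<xi>. q T x \<xi>)"

text \<open>The velocity \<open>\<eta>\<close> of the second component, given the velocity \<open>\<xi>\<close> of the first one and the
  uniform variable \<open>u\<close>. For \<open>x = y\<close> we have \<open>e = 0\<close>, and both branches give \<open>\<eta> = \<xi>\<close>.\<close>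

definition coupled_velocity ::
    "real \<Rightarrow> real \<Rightarrow> 'a::euclidean_space \<Rightarrow> 'a \<Rightarrow> 'a \<Rightarrow> real \<Rightarrow> 'a" where
  "coupled_velocity R \<gamma> x y \<xi> u =
     (if norm (x - y) \<ge> 2 * R then \<xi>
      else let z = x - y; e = z /\<^sub>R norm z in
        if u \<le> std_normal_density (e \<bullet> \<xi> + \<gamma> * norm z) / std_normal_density (e \<bullet> \<xi>)
        then \<xi> + \<gamma> *\<^sub>R z
        else \<xi> - (2 * (e \<bullet> \<xi>)) *\<^sub>R e)"

definition f_metric :: "real \<Rightarrow> real \<Rightarrow> real \<Rightarrow> real" where
  "f_metric a R1 r = integral {0..r} (\<lambda>s. exp (- a * min s R1))"

definition rho ::
    "real \<Rightarrow> real \<Rightarrow> real \<Rightarrow> real \<Rightarrow> ('a::euclidean_space \<Rightarrow> real) \<Rightarrow> 'a \<Rightarrow> 'a \<Rightarrow> real" where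
  "rho a R1 R \<epsilon> \<Psi> x y =
     sqrt (f_metric a R1 (min (norm (x - y)) (2 * R)) * (1 + \<epsilon> * \<Psi> x + \<epsilon> * \<Psi> y))"

end

theory Submission
  imports Defs
begin

text \<open>The semimetric is the geometric mean of two quantities: a bounded concave function \<open>f\<close> of the
  distance, capped at \<open>2 R\<close>, and the weight \<open>1 + \<epsilon> \<Psi> x + \<epsilon> \<Psi> y\<close>. By the Cauchy--Schwarz
  inequality the two may be averaged separately, and in each of two regimes one of them contracts by
  more than the other one can grow (\<open>semimetric_contraction\<close>).

  If \<open>|x - y| \<ge> 2 R\<close>, the capped distance cannot grow, and the drift condition contracts the
  weight, provided that \<open>\<Psi> x + \<Psi> y \<ge> 4 \<alpha> / \<lambda>\<close>. This is obvious if \<open>x\<close> or \<open>y\<close> lies outside of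
  the ball of radius \<open>R\<close>. There remain antipodal points on the sphere of radius \<open>R\<close>, which may
  both belong to the level set; there a two-step exit argument gives \<open>\<Psi> \<ge> 2 \<alpha> / \<lambda>\<close> at each
  of the points (\<open>level_on_boundary\<close>).

  If \<open>|x - y| < 2 R\<close>, the weight can only grow by the factor \<open>1 + 2 \<epsilon> \<alpha>\<close>, and the distance
  contracts. Over the time \<open>T\<close> two trajectories deviate from free flight by a small fraction of their
  separation (\<open>hmc_curve_deviation\<close>), which holds in the same way for the Hamiltonian flow and for
  the Verlet scheme. When the velocities differ by \<open>\<gamma> (x - y)\<close>, the distance is therefore
  multiplied by at most \<open>1 - 3 / 4 \<gamma> T\<close> (\<open>translated_contracts\<close>). This difference is attained
  except with probability of order \<open>\<gamma> |x - y|\<close>, the total variation distance between a normal law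
  and its translate (\<open>reflection_probability_le\<close>), and in the exceptional case
  the loss is controlled by the boundedness of \<open>f\<close> (\<open>expectation_saturating_le\<close>).

  In both regimes the drift condition is applied to the second component as well, which is legitimate
  because the coupled velocity is again standard normal (\<open>distr_mirror_velocity\<close>). This rests on the
  invariance of Lebesgue measure under reflections (\<open>distr_lborel_orthogonal\<close>).\<close>

section \<open>The gradient of the potential\<close>

lemma C1_map_has_derivative:
  assumes "C1_map f"
  shows "(f has_derivative blinfun_apply (fderiv f x)) (at x)"
proof -
  have *: "(f has_derivative frechet_derivative f (at x)) (at x)"
    using assms by (simp add: C1_map_def frechet_derivative_works)
  then show ?thesis
    using bounded_linear_Blinfun_apply[OF has_derivative_bounded_linear[OF *]] by (simp add: fderiv_def)
qed

lemma inner_grad_eq_fderiv: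
  fixes U :: "'a::euclidean_space \<Rightarrow> real"
  assumes "C1_map U"
  shows "grad U x \<bullet> v = fderiv U x v"
proof -
  define D where "D = (\<Sum>b\<in>Basis. fderiv U x b *\<^sub>R b)"
  have D: "v \<bullet> D = fderiv U x v" for v
  proof -
    have "fderiv U x v = fderiv U x (\<Sum>b\<in>Basis. (v \<bullet> b) *\<^sub>R b)"
      by (simp add: euclidean_representation)
    also have "\<dots> = v \<bullet> D"
      by (simp add: D_def blinfun.sum_right blinfun.scaleR_right inner_sum_right mult.commute)
    finally show ?thesis ..
  qed
  then have "blinfun_apply (fderiv U x) = (\<lambda>v. v \<bullet> D)" by auto
  then have G: "GDERIV U x :> D"
    using C1_map_has_derivative[OF assms, of x] by (simp add: gderiv_def)
  have "grad U x = D" unfolding grad_def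
  proof (rule the_equality)
    show "GDERIV U x :> D" by (fact G)
    fix D' assume "GDERIV U x :> D'"
    from has_derivative_unique[OF this[unfolded gderiv_def] G[unfolded gderiv_def]]
    have "v \<bullet> D' = v \<bullet> D" for v by meson
    then show "D' = D" by (metis inner_commute vector_eq_rdot)
  qed
  then show ?thesis using D[of v] by (simp add: inner_commute)
qed

text \<open>A bound on the operator norm of the Hessian is a Lipschitz bound on \<^term>\<open>fderiv U\<close>; the
  gradient inherits it, because evaluating the difference of two derivatives at the difference of
  the corresponding gradients returns the squared norm of the latter.\<close>

lemma grad_lipschitz:
  fixes U :: "'a::euclidean_space \<Rightarrow> real"
  assumes U: "C1_map U" "C1_map (fderiv U)"
    and bound: "\<And>x. norm (fderiv (fderiv U) x) \<le> L"
  shows "norm (grad U x - grad U y) \<le> L * norm (x - y)"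
proof -
  have "norm (fderiv U x - fderiv U y) \<le> L * norm (x - y)"
    by (rule differentiable_bound[where S = UNIV and f' = "\<lambda>x. blinfun_apply (fderiv (fderiv U) x)"])
      (auto simp: C1_map_has_derivative[OF U(2)] bound simp flip: norm_blinfun.rep_eq)
  moreover have "norm (grad U x - grad U y) \<le> norm (fderiv U x - fderiv U y)"
  proof -
    let ?d = "grad U x - grad U y"
    have "norm ?d * norm ?d = ?d \<bullet> ?d" by (simp flip: power2_norm_eq_inner power2_eq_square)
    also have "\<dots> = (fderiv U x - fderiv U y) ?d"
      by (simp only: inner_diff_left[of "grad U x"] inner_grad_eq_fderiv[OF U(1)] blinfun.diff_left)
    also have "\<dots> \<le> norm (fderiv U x - fderiv U y) * norm ?d"
      using norm_blinfun[of "fderiv U x - fderiv U y" ?d] by simp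
    finally show ?thesis by (cases "?d = 0") auto
  qed
  ultimately show ?thesis by simp
qed

lemma grad_local_min:
  fixes U :: "'a::euclidean_space \<Rightarrow> real"
  assumes "C1_map U" and "\<forall>\<^sub>F y in nhds x. U x \<le> U y"
  shows "grad U x = 0"
proof -
  obtain S where S: "open S" "x \<in> S" "\<forall>y\<in>S. U x \<le> U y"
    using assms(2) unfolding eventually_nhds by auto
  have "blinfun_apply (fderiv U x) = (\<lambda>v. 0)"
    using differential_zero_maxmin[OF S(2,1) C1_map_has_derivative[OF assms(1), of x]] S(3) by blast
  then have "grad U x \<bullet> grad U x = 0" by (simp add: inner_grad_eq_fderiv[OF assms(1)])
  then show ?thesis by simp
qed

section \<open>Trajectories and free flight\<close>

text \<open>One system of equations covers both integrators. The velocity Verlet curve evaluates positions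
  and velocities at the neighbouring grid points \<open>lo t\<close> and \<open>hi t\<close>; the Hamiltonian flow is the case
  \<open>h = 0\<close> and \<open>lo t = hi t = t\<close>. The set \<open>S\<close> contains the times at which the right-hand side may jump.\<close>

definition hmc_curve ::
    "('a::euclidean_space \<Rightarrow> 'a) \<Rightarrow> real \<Rightarrow> real \<Rightarrow> real set \<Rightarrow> (real \<Rightarrow> real) \<Rightarrow> (real \<Rightarrow> real)
      \<Rightarrow> (real \<Rightarrow> 'a) \<Rightarrow> (real \<Rightarrow> 'a) \<Rightarrow> bool" where
  "hmc_curve g h T S lo hi q p \<longleftrightarrow> continuous_on {0..T} q \<and> continuous_on {0..T} p \<and>
     (\<forall>t\<in>{0<..<T} - S.
        (q has_vector_derivative p (lo t) - (h / 2) *\<^sub>R g (q (lo t))) (at t) \<and>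
        (p has_vector_derivative - (1 / 2) *\<^sub>R (g (q (lo t)) + g (q (hi t)))) (at t))"

text \<open>This is the mean value inequality for curves that are differentiable off finitely many times,
  with a bound on the speed that is linear in time. Keeping the linear bound instead of its maximum
  yields the factor \<open>1 / 2\<close> in front of \<open>t\<^sup>2\<close>, on which the constants of the coupling depend.\<close>

lemma increment_norm_le_integral:
  fixes f :: "real \<Rightarrow> 'a::euclidean_space"
  assumes S: "finite S" and t: "0 \<le> t" "t \<le> T" and cont: "continuous_on {0..T} f"
    and deriv: "\<And>s. s \<in> {0<..<T} - S \<Longrightarrow> (f has_vector_derivative f' s) (at s)"
    and bound: "\<And>s. s \<in> {0<..<T} - S \<Longrightarrow> norm (f' s) \<le> K * s + C"
  shows "norm (f t - f 0) \<le> K * t\<^sup>2 / 2 + C * t"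
proof -
  \<comment> \<open>The endpoints count as exceptional, since speed and bound are only known in the open interval.\<close>
  define S' where "S' = insert 0 (insert T S)"
  define g where "g s = (if s \<in> S' then 0 else f' s)" for s
  have "(g has_integral (f t - f 0)) {0..t}"
  proof (rule fundamental_theorem_of_calculus_interior_strong)
    show "finite S'" using S by (simp add: S'_def)
    show "continuous_on {0..t} f" using cont t by (auto intro: continuous_on_subset)
    fix s assume "s \<in> {0<..<t} - S'"
    then show "(f has_vector_derivative g s) (at s)" using deriv[of s] t by (auto simp: g_def S'_def)
  qed fact
  then have g: "integral {0..t} g = f t - f 0" "g integrable_on {0..t}" by auto
  define b where "b s = (if s \<in> S' then 0 else K * s + C)" for s
  have "((\<lambda>s. K * s + C) has_integral ((K * t\<^sup>2 / 2 + C * t) - (K * 0\<^sup>2 / 2 + C * 0))) {0..t}"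
    using t by (intro fundamental_theorem_of_calculus)
      (auto intro!: derivative_eq_intros simp: has_real_derivative_iff_has_vector_derivative[symmetric])
  then have *: "((\<lambda>s. K * s + C) has_integral (K * t\<^sup>2 / 2 + C * t)) {0..t}" by simp
  have "(b has_integral (K * t\<^sup>2 / 2 + C * t)) {0..t}"
    by (rule has_integral_spike_finite[OF _ _ *, of S']) (use S in \<open>auto simp: S'_def b_def\<close>)
  then have b: "b integrable_on {0..t}" "integral {0..t} b = K * t\<^sup>2 / 2 + C * t" by auto
  have "norm (integral {0..t} g) \<le> integral {0..t} b"
    using bound t by (intro integral_norm_bound_integral g b) (auto simp: g_def b_def S'_def)
  then show ?thesis using g b by simp
qed

lemma hmc_curve_zero: "g 0 = 0 \<Longrightarrow> hmc_curve g h T S lo hi (\<lambda>_. 0) (\<lambda>_. 0)"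
  by (auto simp: hmc_curve_def)

text \<open>A free flight is a segment, so that its norm is largest at an endpoint.\<close>

lemma norm_convex_combination_le:
  fixes a b :: "'a::real_normed_vector"
  assumes "0 \<le> s" "s \<le> T" "0 < T"
  shows "norm (a + s *\<^sub>R b) \<le> max (norm a) (norm (a + T *\<^sub>R b))"
proof -
  let ?u = "s / T"
  have u: "0 \<le> ?u" "?u \<le> 1" using assms by (auto simp: field_simps)
  have "a + s *\<^sub>R b = (1 - ?u) *\<^sub>R a + ?u *\<^sub>R (a + T *\<^sub>R b)"
    using assms by (simp add: algebra_simps)
  then have "norm (a + s *\<^sub>R b) \<le> (1 - ?u) * norm a + ?u * norm (a + T *\<^sub>R b)"
    using u by (metis norm_triangle_ineq norm_scaleR abs_of_nonneg diff_ge_0_iff_ge)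
  also have "\<dots> \<le> (1 - ?u) * max (norm a) (norm (a + T *\<^sub>R b)) + ?u * max (norm a) (norm (a + T *\<^sub>R b))"
    using u by (intro add_mono mult_left_mono) auto
  also have "\<dots> = max (norm a) (norm (a + T *\<^sub>R b))" by (simp add: algebra_simps)
  finally show ?thesis .
qed

text \<open>Two trajectories separate almost as they would in free flight. If \<open>K\<close> bounds the difference
  of the forces on \<open>[0, T]\<close>, the difference of the velocities changes by at most \<open>K t\<close> up to time
  \<open>t\<close>, and hence the difference of the positions deviates from free flight by at most
  \<open>K (t\<^sup>2 + h t) / 2\<close>. Here \<open>K\<close> is \<open>L\<close> times the largest separation, which is in turn at most
  the largest separation in free flight plus the deviation itself. As
  \<open>L (T\<^sup>2 + T h) \<le> 1\<close>, at least half of the largest separation remains after the deviation has been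
  subtracted, and the factor 2 that arises cancels the factor \<open>1 / 2\<close>.\<close>

lemma hmc_curve_deviation:
  fixes q p q' p' :: "real \<Rightarrow> 'a::euclidean_space"
  assumes T: "0 < T" and h: "0 \<le> h" and S: "finite S"
    and grid: "\<And>t. t \<in> {0<..<T} - S \<Longrightarrow> lo t \<in> {0..t} \<and> hi t \<in> {0..T}"
    and lip: "\<And>x y. norm (g x - g y) \<le> L * norm (x - y)" and L: "0 \<le> L"
    and small: "L * (T\<^sup>2 + T * h) \<le> 1"
    and curves: "hmc_curve g h T S lo hi q p" "hmc_curve g h T S lo hi q' p'"
  shows "norm ((q T - q' T) - ((q 0 - q' 0) + T *\<^sub>R (p 0 - p' 0)))
    \<le> L * (T\<^sup>2 + T * h) * max (norm (q 0 - q' 0)) (norm ((q 0 - q' 0) + T *\<^sub>R (p 0 - p' 0)))"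
proof -
  define z where "z t = q t - q' t" for t
  define w where "w t = p t - p' t" for t
  have cz: "continuous_on {0..T} z" and cw: "continuous_on {0..T} w"
    using curves unfolding hmc_curve_def z_def w_def by (auto intro!: continuous_intros)
  obtain s where s: "s \<in> {0..T}" and smax: "\<And>t. t \<in> {0..T} \<Longrightarrow> norm (z t) \<le> norm (z s)"
    using continuous_attains_sup[of "{0..T}" "\<lambda>t. norm (z t)"] continuous_on_norm[OF cz] T by force
  define K where "K = L * norm (z s)"
  have K0: "0 \<le> K" using L by (simp add: K_def)
  have g_le: "norm (g (q t) - g (q' t)) \<le> K" if "t \<in> {0..T}" for t
    using lip[of "q t" "q' t"] mult_left_mono[OF smax[OF that] L] by (simp add: z_def K_def)
  have w_le: "norm (w t - w 0) \<le> K * t" if "t \<in> {0..T}" for t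
  proof -
    let ?w' = "\<lambda>t. - (1/2) *\<^sub>R (g (q (lo t)) + g (q (hi t))) - - (1/2) *\<^sub>R (g (q' (lo t)) + g (q' (hi t)))"
    have "norm (w t - w 0) \<le> 0 * t\<^sup>2 / 2 + K * t"
    proof (rule increment_norm_le_integral[OF S _ _ cw, where f' = ?w'])
      fix t assume t: "t \<in> {0<..<T} - S"
      show "(w has_vector_derivative ?w' t) (at t)"
        using curves t unfolding w_def hmc_curve_def by (intro has_vector_derivative_diff) blast+
      have "?w' t = - ((1/2) *\<^sub>R (g (q (lo t)) - g (q' (lo t))) + (1/2) *\<^sub>R (g (q (hi t)) - g (q' (hi t))))"
        by (simp add: algebra_simps)
      also have "norm \<dots> \<le> (1/2) * norm (g (q (lo t)) - g (q' (lo t))) + (1/2) * norm (g (q (hi t)) - g (q' (hi t)))"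
        unfolding norm_minus_cancel by (rule order_trans[OF norm_triangle_ineq]) simp
      also have "\<dots> \<le> K" using g_le[of "lo t"] g_le[of "hi t"] grid[OF t] t by auto
      finally show "norm (?w' t) \<le> 0 * t + K" by simp
    qed (use that in auto)
    then show ?thesis by simp
  qed
  let ?A = "L * (T\<^sup>2 + T * h)"
  have z_le: "norm (z t - (z 0 + t *\<^sub>R w 0)) \<le> ?A / 2 * norm (z s)" if t: "t \<in> {0..T}" for t
  proof -
    let ?d = "\<lambda>t. z t - t *\<^sub>R w 0"
    let ?z' = "\<lambda>t. ((p (lo t) - (h/2) *\<^sub>R g (q (lo t))) - (p' (lo t) - (h/2) *\<^sub>R g (q' (lo t)))) - w 0"
    have "norm (?d t - ?d 0) \<le> K * t\<^sup>2 / 2 + (K * h / 2) * t"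
    proof (rule increment_norm_le_integral[OF S, where f' = ?z' and T = T])
      show "continuous_on {0..T} ?d" by (intro continuous_intros cz)
      fix t assume t: "t \<in> {0<..<T} - S"
      show "(?d has_vector_derivative ?z' t) (at t)"
        using curves t unfolding z_def hmc_curve_def
        by (intro has_vector_derivative_diff) (auto intro!: derivative_eq_intros)
      have "?z' t = (w (lo t) - w 0) - (h/2) *\<^sub>R (g (q (lo t)) - g (q' (lo t)))"
        by (simp add: w_def algebra_simps)
      also have "norm \<dots> \<le> norm (w (lo t) - w 0) + (h/2) * norm (g (q (lo t)) - g (q' (lo t)))"
        using h by (intro order_trans[OF norm_triangle_ineq4]) simp
      also have "\<dots> \<le> K * lo t + (h/2) * K"
        using grid[OF t] t h by (intro add_mono w_le mult_left_mono g_le) auto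
      also have "\<dots> \<le> K * t + K * h / 2" using grid[OF t] mult_left_mono[OF _ K0, of "lo t" t]
        by (auto simp: mult.commute)
      finally show "norm (?z' t) \<le> K * t + K * h / 2" .
    qed (use t in auto)
    also have "\<dots> \<le> K * T\<^sup>2 / 2 + (K * h / 2) * T"
      using t K0 h by (intro add_mono mult_left_mono divide_right_mono power_mono) auto
    also have "\<dots> = ?A / 2 * norm (z s)" by (simp add: K_def power2_eq_square algebra_simps)
    finally show ?thesis by (simp add: algebra_simps)
  qed
  let ?m = "max (norm (z 0)) (norm (z 0 + T *\<^sub>R w 0))"
  have "norm (z s) \<le> norm (z s - (z 0 + s *\<^sub>R w 0)) + norm (z 0 + s *\<^sub>R w 0)"
    using norm_triangle_ineq[of "z s - (z 0 + s *\<^sub>R w 0)" "z 0 + s *\<^sub>R w 0"] by simp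
  also have "\<dots> \<le> ?A / 2 * norm (z s) + ?m"
    using z_le[OF s] norm_convex_combination_le[of s T "z 0" "w 0"] s T by auto
  also have "\<dots> \<le> 1 / 2 * norm (z s) + ?m" using small by (intro add_mono mult_right_mono) auto
  finally have "norm (z s) \<le> 2 * ?m" by simp
  moreover have "0 \<le> ?A" using L T h by simp
  ultimately have "?A / 2 * norm (z s) \<le> ?A / 2 * (2 * ?m)" by (intro mult_left_mono) auto
  then have "norm (z T - (z 0 + T *\<^sub>R w 0)) \<le> ?A * ?m" using z_le[of T] T by simp
  then show ?thesis by (simp add: z_def w_def)
qed

lemma exact_flow_hmc_curve:
  assumes "exact_flow U q p"
  shows "hmc_curve (grad U) 0 T {} (\<lambda>t. t) (\<lambda>t. t) (\<lambda>t. q t x v) (\<lambda>t. p t x v)"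
proof -
  have d: "((\<lambda>s. q s x v) has_vector_derivative p t x v) (at t within {0..})"
    "((\<lambda>s. p s x v) has_vector_derivative - grad U (q t x v)) (at t within {0..})" if "0 \<le> t" for t
    using assms that unfolding exact_flow_def by blast+
  have "continuous_on {0..} (\<lambda>t. q t x v)" "continuous_on {0..} (\<lambda>t. p t x v)"
    using d by (auto intro!: continuous_at_imp_continuous_on has_vector_derivative_continuous
        simp: continuous_on_eq_continuous_within)
  then have "continuous_on {0..T} (\<lambda>t. q t x v)" "continuous_on {0..T} (\<lambda>t. p t x v)"
    by (auto elim: continuous_on_subset)
  moreover have "at t within {0..} = at t" if "0 < t" for t :: real
    using that by (intro at_within_interior) auto
  then have "((\<lambda>s. q s x v) has_vector_derivative p t x v) (at t)"
    "((\<lambda>s. p s x v) has_vector_derivative - grad U (q t x v)) (at t)" if "0 < t" for t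
    using d[of t] that by auto
  moreover have "(1 / 2) *\<^sub>R (y + y) = y" for y :: 'a by (simp flip: scaleR_2)
  ultimately show ?thesis by (simp add: hmc_curve_def)
qed

lemma finite_grid_Int: "0 < h \<Longrightarrow> finite (grid h \<inter> {0..T})"
proof -
  assume h: "0 < h"
  have "grid h \<inter> {0..T} \<subseteq> (\<lambda>k. h * of_int k) ` {0..\<lceil>T / h\<rceil>}"
  proof
    fix s assume "s \<in> grid h \<inter> {0..T}"
    then obtain k :: int where k: "s = h * of_int k" "0 \<le> h * of_int k" "h * of_int k \<le> T"
      by (auto simp: grid_def)
    then have "of_int k \<le> T / h" using h by (simp add: field_simps)
    then have "k \<le> \<lceil>T / h\<rceil>" by linarith
    moreover have "0 \<le> k" using k(2) h by (simp add: zero_le_mult_iff)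
    ultimately show "s \<in> (\<lambda>k. h * of_int k) ` {0..\<lceil>T / h\<rceil>}" using k(1) by auto
  qed
  then show ?thesis by (rule finite_subset) simp
qed

lemma grid_bounds:
  assumes h: "0 < h" and Th: "T / h \<in> \<int>" and t: "0 < t" "t < T"
  shows "grid_floor h t \<in> {0..t}" and "grid_ceiling h t \<in> {0..T}"
proof -
  obtain n :: int where n: "T / h = of_int n" using Th by (auto elim: Ints_cases)
  have "0 \<le> \<lfloor>t / h\<rfloor>" using h t by simp
  moreover have "h * of_int \<lfloor>t / h\<rfloor> \<le> h * (t / h)" using h by (intro mult_left_mono) auto
  ultimately show "grid_floor h t \<in> {0..t}" using h by (simp add: grid_floor_eq)
  have "\<lceil>t / h\<rceil> \<le> n" using n t h divide_right_mono[of t T h] by (simp add: ceiling_le_iff)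
  then have "of_int \<lceil>t / h\<rceil> \<le> T / h" using n by simp
  then have "h * of_int \<lceil>t / h\<rceil> \<le> h * (T / h)" using h by (intro mult_left_mono) auto
  moreover have "0 \<le> t / h" using h t by simp
  then have "0 \<le> \<lceil>t / h\<rceil>" by linarith
  ultimately show "grid_ceiling h t \<in> {0..T}" using h by (simp add: grid_ceiling_eq)
qed

lemma verlet_flow_hmc_curve:
  assumes "verlet_flow U h q p"
  shows "hmc_curve (grad U) h T (grid h \<inter> {0..T}) (grid_floor h) (grid_ceiling h)
    (\<lambda>t. q t x v) (\<lambda>t. p t x v)"
proof -
  have "continuous_on {0..} (\<lambda>t. q t x v)" "continuous_on {0..} (\<lambda>t. p t x v)"
    using assms unfolding verlet_flow_def by blast+
  then have "continuous_on {0..T} (\<lambda>t. q t x v)" "continuous_on {0..T} (\<lambda>t. p t x v)"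
    by (auto elim: continuous_on_subset)
  moreover have "0 < t \<and> t \<notin> grid h" if "t \<in> {0<..<T} - grid h \<inter> {0..T}" for t
    using that by auto
  ultimately show ?thesis using assms unfolding hmc_curve_def verlet_flow_def by blast
qed

text \<open>This is all that the coupling argument needs to know about the transition map
  \<open>Q x v = q\<^sub>T(x, v)\<close>. The second clause is the first one for the trajectory that rests at the
  critical point 0.\<close>

definition near_free_flight :: "real \<Rightarrow> real \<Rightarrow> ('a::euclidean_space \<Rightarrow> 'a \<Rightarrow> 'a) \<Rightarrow> bool" where
  "near_free_flight T \<theta> Q \<longleftrightarrow>
     (\<forall>x v y w. norm ((Q x v - Q y w) - ((x - y) + T *\<^sub>R (v - w)))
        \<le> \<theta> * max (norm (x - y)) (norm ((x - y) + T *\<^sub>R (v - w)))) \<and>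
     (\<forall>x v. norm (Q x v - (x + T *\<^sub>R v)) \<le> \<theta> * max (norm x) (norm (x + T *\<^sub>R v)))"

lemma hmc_near_free_flight:
  fixes q p :: "real \<Rightarrow> 'a \<Rightarrow> 'a \<Rightarrow> 'a::euclidean_space"
  assumes lip: "\<And>x y. norm (grad U x - grad U y) \<le> L * norm (x - y)" and L: "0 \<le> L"
    and grad0: "grad U 0 = 0" and T: "0 < T" and h1: "0 < h1"
    and small: "L * (T * (T + h1)) \<le> 1"
    and flow: "exact_flow U q p \<or> (\<exists>h. 0 < h \<and> h \<le> h1 \<and> T / h \<in> \<int> \<and> verlet_flow U h q p)"
  shows "near_free_flight T (L * (T * (T + h1))) (q T)"
proof -
  obtain h :: real and S lo hi where h: "0 \<le> h" "h \<le> h1" and S: "finite S"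
    and grid: "\<And>t. t \<in> {0<..<T} - S \<Longrightarrow> lo t \<in> {0..t} \<and> hi t \<in> {0..T}"
    and curve: "\<And>x v. hmc_curve (grad U) h T S lo hi (\<lambda>t. q t x v) (\<lambda>t. p t x v)"
    and init: "\<And>x v. q 0 x v = x \<and> p 0 x v = v"
    using flow
  proof (elim disjE exE conjE)
    assume *: "exact_flow U q p"
    show ?thesis
    proof (rule that[of 0 "{}" "\<lambda>t. t" "\<lambda>t. t"])
      show "(0::real) \<le> 0" "0 \<le> h1" using h1 by auto
      show "finite ({} :: real set)" by simp
      show "q 0 x v = x \<and> p 0 x v = v" for x v using * unfolding exact_flow_def by blast
    qed (auto intro: exact_flow_hmc_curve[OF *])
  next
    fix h assume h: "0 < h" "h \<le> h1" "T / h \<in> \<int>" and *: "verlet_flow U h q p"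
    show ?thesis
    proof (rule that[of h "grid h \<inter> {0..T}" "grid_floor h" "grid_ceiling h"])
      show "0 \<le> h" "h \<le> h1" using h by auto
      show "finite (grid h \<inter> {0..T})" using h by (intro finite_grid_Int)
      show "grid_floor h t \<in> {0..t} \<and> grid_ceiling h t \<in> {0..T}"
        if "t \<in> {0<..<T} - grid h \<inter> {0..T}" for t
        using grid_bounds[OF h(1,3), of t] that by auto
      show "q 0 x v = x \<and> p 0 x v = v" for x v using * unfolding verlet_flow_def by blast
    qed (rule verlet_flow_hmc_curve[OF *])
  qed
  have le: "L * (T\<^sup>2 + T * h) \<le> L * (T * (T + h1))"
    using L T h by (intro mult_left_mono) (auto simp: power2_eq_square algebra_simps)
  have le1: "L * (T\<^sup>2 + T * h) \<le> 1" using le small by simp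
  note dev = hmc_curve_deviation[OF T h(1) S grid lip L le1]
  show ?thesis unfolding near_free_flight_def
  proof (intro conjI allI)
    fix x v y w :: 'a
    show "norm ((q T x v - q T y w) - ((x - y) + T *\<^sub>R (v - w)))
        \<le> L * (T * (T + h1)) * max (norm (x - y)) (norm ((x - y) + T *\<^sub>R (v - w)))"
      using order_trans[OF dev[OF _ curve[of x v] curve[of y w]] mult_right_mono[OF le]]
      by (simp add: init le_max_iff_disj)
    show "norm (q T x v - (x + T *\<^sub>R v)) \<le> L * (T * (T + h1)) * max (norm x) (norm (x + T *\<^sub>R v))"
      using order_trans[OF dev[OF _ curve[of x v] hmc_curve_zero[of "grad U"]] mult_right_mono[OF le]]
      by (simp add: init grad0 le_max_iff_disj)
  qed
qed

lemma near_free_flight_lipschitz: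
  assumes "near_free_flight T \<theta> Q" "0 \<le> T"
  shows "norm (Q x v - Q x w) \<le> (1 + \<theta>) * T * norm (v - w)"
proof -
  have "norm ((Q x v - Q x w) - T *\<^sub>R (v - w)) \<le> \<theta> * (T * norm (v - w))"
    using assms unfolding near_free_flight_def
    by (metis (no_types, opaque_lifting) abs_of_nonneg add_0 cancel_comm_monoid_add_class.diff_cancel
        max_absorb2 norm_ge_zero norm_scaleR norm_zero)
  moreover have "norm (Q x v - Q x w) \<le> norm ((Q x v - Q x w) - T *\<^sub>R (v - w)) + T * norm (v - w)"
    using norm_triangle_ineq[of "(Q x v - Q x w) - T *\<^sub>R (v - w)" "T *\<^sub>R (v - w)"] assms(2) by simp
  ultimately show ?thesis by (simp add: algebra_simps)
qed

lemma near_free_flight_measurable: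
  assumes "near_free_flight T \<theta> Q" "0 \<le> T" "0 \<le> \<theta>"
  shows "Q x \<in> borel_measurable borel"
proof -
  have "((1 + \<theta>) * T)-lipschitz_on UNIV (Q x)"
    using near_free_flight_lipschitz[OF assms(1,2)] assms(2,3)
    by (intro lipschitz_onI) (auto simp: dist_norm)
  then show ?thesis by (intro borel_measurable_continuous_onI lipschitz_on_continuous_on)
qed

section \<open>Gaussian vectors and reflections\<close>

lemma nn_integral_lborel_shift:
  fixes f :: "'a::euclidean_space \<Rightarrow> ennreal"
  assumes [measurable]: "f \<in> borel_measurable borel"
  shows "(\<integral>\<^sup>+x. f (x + c) \<partial>lborel) = (\<integral>\<^sup>+x. f x \<partial>lborel)"
proof -
  have "(\<integral>\<^sup>+x. f x \<partial>lborel) = (\<integral>\<^sup>+x. f x \<partial>distr lborel borel ((+) c))"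
    by (simp add: lborel_distr_plus)
  also have "\<dots> = (\<integral>\<^sup>+x. f (x + c) \<partial>lborel)" by (simp add: nn_integral_distr add.commute)
  finally show ?thesis ..
qed

lemma emeasure_distr_nn_integral:
  assumes "f \<in> measurable M N" "A \<in> sets N"
  shows "emeasure (distr M N f) A = (\<integral>\<^sup>+x. indicator A (f x) \<partial>M)"
  using assms by (simp flip: nn_integral_indicator add: nn_integral_distr)

text \<open>Two translation invariant measures are proportional, and an orthogonal transformation maps
  the unit ball \<open>B\<close> to itself, so that the factor is 1. In the proof, the product of the two volumes
  of \<open>A\<close> and \<open>B\<close> is written as a double integral, in which alternately one variable is translated
  by (the image of) the other; this turns the image measure of \<open>A\<close> into the volume of \<open>A\<close>.\<close>

lemma distr_lborel_orthogonal:
  fixes g :: "'a::euclidean_space \<Rightarrow> 'a"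
  assumes g: "orthogonal_transformation g"
  shows "distr lborel borel g = lborel"
proof (rule measure_eqI)
  have [measurable]: "g \<in> borel_measurable borel"
    using g by (intro borel_measurable_continuous_onI linear_continuous_on)
      (auto simp: orthogonal_transformation_def linear_conv_bounded_linear)
  have add: "g (x + y) = g x + g y" for x y
    using g by (simp add: orthogonal_transformation_def linear_add)
  define g' where "g' = inv g"
  have gg': "g (g' y) = y" for y
    using orthogonal_transformation_surj[OF g] by (simp add: g'_def surj_f_inv_f)
  define B where "B = ball (0::'a) 1"
  have [measurable]: "B \<in> sets borel" by (simp add: B_def)
  have B: "emeasure lborel B \<noteq> 0" "emeasure lborel B \<noteq> \<infinity>"
  proof -
    have "emeasure lborel B = ennreal (unit_ball_vol (real DIM('a)))"
      using emeasure_ball[of 1 "0::'a"] by (simp add: B_def)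
    moreover have "0 < unit_ball_vol (real DIM('a))" by simp
    ultimately show "emeasure lborel B \<noteq> 0" "emeasure lborel B \<noteq> \<infinity>"
      by (metis ennreal_eq_0_iff not_le, simp)
  qed
  fix A :: "'a set" assume "A \<in> sets (distr lborel borel g)"
  then have [measurable]: "A \<in> sets borel" by simp
  have B_shift: "(\<integral>\<^sup>+x. indicator B (y - g x) \<partial>lborel) = emeasure lborel B" for y
  proof -
    have "indicator B (y - g (x + g' y)) = (indicator B x :: ennreal)" for x
      using orthogonal_transformation_norm[OF g, of x]
      by (auto simp: B_def add gg' indicator_def)
    then have "(\<integral>\<^sup>+x. indicator B (y - g (x + g' y)) \<partial>lborel) = emeasure lborel B" by simp
    then show ?thesis
      using nn_integral_lborel_shift[of "\<lambda>x. indicator B (y - g x)" "g' y"] by simp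
  qed
  have "emeasure (distr lborel borel g) A * emeasure lborel B
      = (\<integral>\<^sup>+y. indicator B y * (\<integral>\<^sup>+x. indicator A (g x) \<partial>lborel) \<partial>lborel)"
  proof -
    have "emeasure (distr lborel borel g) A = (\<integral>\<^sup>+x. indicator A (g x) \<partial>lborel)"
      by (simp add: emeasure_distr_nn_integral)
    then show ?thesis by (simp add: nn_integral_multc mult.commute)
  qed
  also have "\<dots> = (\<integral>\<^sup>+y. (\<integral>\<^sup>+x. indicator B y * indicator A (g x + y) \<partial>lborel) \<partial>lborel)"
  proof (rule nn_integral_cong)
    fix y :: 'a
    have "(\<integral>\<^sup>+x. indicator A (g x) \<partial>lborel) = (\<integral>\<^sup>+x. indicator A (g x + y) \<partial>lborel)"
      using nn_integral_lborel_shift[of "\<lambda>x. indicator A (g x)" "g' y"] by (simp add: add gg')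
    then show "indicator B y * (\<integral>\<^sup>+x. indicator A (g x) \<partial>lborel)
        = (\<integral>\<^sup>+x. indicator B y * indicator A (g x + y) \<partial>lborel)"
      by (simp add: nn_integral_cmult)
  qed
  also have "\<dots> = (\<integral>\<^sup>+x. (\<integral>\<^sup>+y. indicator B y * indicator A (g x + y) \<partial>lborel) \<partial>lborel)"
    by (rule lborel_pair.Fubini') measurable
  also have "\<dots> = (\<integral>\<^sup>+x. (\<integral>\<^sup>+y. indicator B (y - g x) * indicator A y \<partial>lborel) \<partial>lborel)"
  proof (rule nn_integral_cong)
    fix x :: 'a
    show "(\<integral>\<^sup>+y. indicator B y * indicator A (g x + y) \<partial>lborel)
        = (\<integral>\<^sup>+y. indicator B (y - g x) * indicator A y \<partial>lborel)"
      using nn_integral_lborel_shift[of "\<lambda>y. indicator B (y - g x) * indicator A y" "g x"]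
      by (simp add: add.commute)
  qed
  also have "\<dots> = (\<integral>\<^sup>+y. (\<integral>\<^sup>+x. indicator B (y - g x) * indicator A y \<partial>lborel) \<partial>lborel)"
    by (rule lborel_pair.Fubini') measurable
  also have "\<dots> = (\<integral>\<^sup>+y. emeasure lborel B * indicator A y \<partial>lborel)"
    by (intro nn_integral_cong) (simp add: nn_integral_multc B_shift)
  also have "\<dots> = emeasure lborel A * emeasure lborel B"
    by (subst nn_integral_cmult_indicator) (simp_all add: mult.commute)
  finally show "emeasure (distr lborel borel g) A = emeasure lborel A"
    using B by (metis ennreal_mult_cancel_left infinity_ennreal_def mult.commute)
qed simp

definition reflection :: "'a::euclidean_space \<Rightarrow> 'a \<Rightarrow> 'a" where
  "reflection e x = x - (2 * (e \<bullet> x)) *\<^sub>R e"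

lemma reflection_orthogonal:
  assumes "norm e = 1"
  shows "orthogonal_transformation (reflection e)"
proof -
  have e: "e \<bullet> e = 1" using assms by (simp add: norm_eq_1)
  have "linear (reflection e)"
    by (intro linearI) (auto simp: reflection_def algebra_simps inner_simps)
  moreover have "reflection e v \<bullet> reflection e w = v \<bullet> w" for v w
    by (simp add: reflection_def inner_simps e algebra_simps inner_commute)
  ultimately show ?thesis by (simp add: orthogonal_transformation_def)
qed

lemma reflection_involution:
  assumes "norm e = 1"
  shows "reflection e (reflection e x) = x"
proof -
  have "e \<bullet> e = 1" using assms by (simp add: norm_eq_1)
  then show ?thesis by (simp add: reflection_def inner_simps algebra_simps)
qed

lemma reflection_measurable [measurable]: "reflection e \<in> borel_measurable borel"
  unfolding reflection_def by measurable

text \<open>The reflection in the bisector of two unit vectors exchanges them, hence also their coordinate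
  functionals.\<close>

lemma obtain_reflection:
  fixes a b :: "'a::euclidean_space"
  assumes "norm a = 1" "norm b = 1" "a \<noteq> b"
  obtains n where "norm n = 1" "\<And>x. a \<bullet> reflection n x = b \<bullet> x"
proof -
  define k where "k = norm (a - b)"
  define n where "n = (a - b) /\<^sub>R k"
  have k: "k > 0" using assms(3) by (simp add: k_def)
  have ab: "a \<bullet> a = 1" "b \<bullet> b = 1" using assms by (auto simp: norm_eq_1)
  have "k\<^sup>2 = 2 - 2 * (a \<bullet> b)"
    by (simp add: k_def power2_norm_eq_inner inner_simps ab inner_commute)
  then have an: "2 * (a \<bullet> n) = k"
    using k by (simp add: n_def inner_simps ab field_simps power2_eq_square)
  show ?thesis
  proof
    show "norm n = 1" using k by (simp add: n_def k_def)
    fix x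
    have "a \<bullet> reflection n x = a \<bullet> x - (2 * (a \<bullet> n)) * (n \<bullet> x)" by (simp add: reflection_def inner_simps)
    also have "\<dots> = b \<bullet> x" using k by (simp add: an) (simp add: n_def inner_simps field_simps)
    finally show "a \<bullet> reflection n x = b \<bullet> x" .
  qed
qed

definition gauss_density :: "'a::euclidean_space \<Rightarrow> real" where
  "gauss_density x = exp (- (norm x)\<^sup>2 / 2) / sqrt (2 * pi) ^ DIM('a)"

lemma gauss_density_measurable [measurable]: "gauss_density \<in> borel_measurable borel"
  unfolding gauss_density_def by measurable

lemma gauss_density_pos: "0 < gauss_density x"
  by (simp add: gauss_density_def)

lemma std_gaussian_eq: "std_gaussian = density lborel gauss_density"
  by (simp add: std_gaussian_def gauss_density_def)

lemma sets_std_gaussian [simp, measurable_cong]: "sets std_gaussian = sets borel"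
  by (simp add: std_gaussian_eq)

lemma space_std_gaussian [simp]: "space std_gaussian = UNIV"
  by (simp add: std_gaussian_eq)

lemma gauss_density_prod:
  "gauss_density (x :: 'a::euclidean_space) = (\<Prod>b\<in>Basis. std_normal_density (x \<bullet> b))"
proof -
  have "(norm x)\<^sup>2 = (\<Sum>b\<in>Basis. (x \<bullet> b)\<^sup>2)"
    unfolding power2_norm_eq_inner by (subst euclidean_inner) (simp add: power2_eq_square)
  then have "- (norm x)\<^sup>2 / 2 = (\<Sum>b\<in>Basis. - (x \<bullet> b)\<^sup>2 / 2)"
    by (simp add: sum_negf sum_divide_distrib)
  then have "exp (- (norm x)\<^sup>2 / 2) = (\<Prod>b\<in>Basis. exp (- (x \<bullet> b)\<^sup>2 / 2))"
    by (simp only: exp_sum finite_Basis)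
  then show ?thesis
    by (simp add: gauss_density_def std_normal_density_def prod_dividef)
qed

abbreviation std_normal :: "real measure" where
  "std_normal \<equiv> density lborel std_normal_density"

lemma prob_space_std_normal: "prob_space std_normal"
  by (rule prob_space_normal_density) simp

lemma distr_std_gaussian_orthogonal:
  fixes g :: "'a::euclidean_space \<Rightarrow> 'a"
  assumes g: "orthogonal_transformation g"
  shows "distr std_gaussian borel g = std_gaussian"
proof (rule measure_eqI)
  have [measurable]: "g \<in> borel_measurable borel"
    using g by (intro borel_measurable_continuous_onI linear_continuous_on)
      (auto simp: orthogonal_transformation_def linear_conv_bounded_linear)
  have dg: "gauss_density (g x) = gauss_density x" for x
    using orthogonal_transformation_norm[OF g] by (simp add: gauss_density_def)
  fix A :: "'a set" assume "A \<in> sets (distr std_gaussian borel g)"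
  then have [measurable]: "A \<in> sets borel" by simp
  have "emeasure (distr std_gaussian borel g) A = (\<integral>\<^sup>+x. ennreal (gauss_density x) * indicator A (g x) \<partial>lborel)"
    by (simp add: emeasure_distr_nn_integral std_gaussian_eq nn_integral_density)
  also have "\<dots> = (\<integral>\<^sup>+x. ennreal (gauss_density x) * indicator A x \<partial>distr lborel borel g)"
    by (simp add: nn_integral_distr dg)
  also have "\<dots> = emeasure std_gaussian A"
    by (simp add: distr_lborel_orthogonal[OF g] std_gaussian_eq emeasure_density)
  finally show "emeasure (distr std_gaussian borel g) A = emeasure std_gaussian A" .
qed simp

lemma distr_std_gaussian_basis:
  assumes b: "b \<in> Basis"
  shows "distr std_gaussian borel (\<lambda>x. b \<bullet> x) = (std_normal :: real measure)"
proof (rule measure_eqI)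
  fix A :: "real set" assume "A \<in> sets (distr std_gaussian borel ((\<bullet>) b))"
  then have [measurable]: "A \<in> sets borel" by simp
  let ?f = "\<lambda>b' t. ennreal (std_normal_density t) * (if b' = b then indicator A t else 1)"
  have "emeasure (distr std_gaussian borel ((\<bullet>) b)) A
      = (\<integral>\<^sup>+x. ennreal (gauss_density x) * indicator A (b \<bullet> x) \<partial>lborel)"
    by (simp add: emeasure_distr_nn_integral std_gaussian_eq nn_integral_density)
  also have "\<dots> = (\<integral>\<^sup>+x. (\<Prod>b'\<in>Basis. ?f b' (x \<bullet> b')) \<partial>lborel)"
    using b by (intro nn_integral_cong)
      (simp add: prod.distrib gauss_density_prod prod_ennreal prod.delta inner_commute)
  also have "\<dots> = (\<Prod>b'\<in>Basis. (\<integral>\<^sup>+t. ?f b' t \<partial>lborel))"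
    by (rule nn_integral_lborel_prod) auto
  also have "\<dots> = (\<Prod>b'\<in>Basis. if b' = b then emeasure std_normal A else 1)"
    using prob_space.emeasure_space_1[OF prob_space_std_normal]
    by (intro prod.cong) (auto simp: emeasure_density)
  also have "\<dots> = emeasure std_normal A" using b by (simp add: prod.delta)
  finally show "emeasure (distr std_gaussian borel ((\<bullet>) b)) A = emeasure std_normal A" .
qed simp

text \<open>For a basis vector this is the product structure of the density, and by reflection invariance
  all unit vectors are alike.\<close>

lemma distr_std_gaussian_inner:
  fixes e :: "'a::euclidean_space"
  assumes e: "norm e = 1"
  shows "distr std_gaussian borel (\<lambda>x. e \<bullet> x) = std_normal"
proof -
  obtain b :: 'a where b: "b \<in> Basis" using nonempty_Basis by blast
  show ?thesis
  proof (cases "e = b")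
    case True
    then show ?thesis using distr_std_gaussian_basis[OF b] by simp
  next
    case False
    then obtain n where n: "norm n = 1" "\<And>x. b \<bullet> reflection n x = e \<bullet> x"
      using obtain_reflection[of b e] e b by (metis norm_Basis)
    have "distr std_gaussian borel (\<lambda>x. e \<bullet> x)
        = distr (distr std_gaussian borel (reflection n)) borel (\<lambda>x. b \<bullet> x)"
      by (subst distr_distr) (auto simp: comp_def n(2))
    then show ?thesis
      by (simp add: distr_std_gaussian_orthogonal reflection_orthogonal n(1) distr_std_gaussian_basis b)
  qed
qed

lemma prob_space_std_gaussian: "prob_space (std_gaussian :: 'a::euclidean_space measure)"
proof -
  obtain b :: 'a where "b \<in> Basis" using nonempty_Basis by blast
  then have "prob_space (distr std_gaussian borel (\<lambda>x::'a. b \<bullet> x))"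
    by (simp add: distr_std_gaussian_basis prob_space_std_normal)
  then show ?thesis by (rule prob_space_distrD[rotated]) simp
qed

section \<open>Quantitative bounds for the normal law\<close>

text \<open>The maximum of the density is \<open>1 / sqrt (2 \<pi>) = 0.3989\<dots>\<close>; the bound \<open>5 / 12\<close> follows
  from \<open>\<pi> > 3\<close> and is sharp enough for the constants of the coupling.\<close>

lemma std_normal_density_le: "std_normal_density t \<le> 5 / 12"
proof -
  have "12 / 5 \<le> sqrt (2 * pi)"
    using pi_gt3 by (intro real_le_rsqrt) (simp add: power2_eq_square)
  then have "1 / sqrt (2 * pi) \<le> 1 / (12 / 5)" by (intro divide_left_mono) auto
  moreover have "1 / sqrt (2 * pi) * exp (- t\<^sup>2 / 2) \<le> 1 / sqrt (2 * pi) * 1"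
    by (intro mult_left_mono) auto
  ultimately have "1 / sqrt (2 * pi) * exp (- t\<^sup>2 / 2) \<le> 1 / (12 / 5)" by linarith
  then show ?thesis by (simp add: std_normal_density_def)
qed

lemma std_normal_density_ge:
  assumes "\<bar>t\<bar> \<le> 1 / 2"
  shows "3 / 10 \<le> std_normal_density t"
proof -
  have "t\<^sup>2 \<le> (1 / 2)\<^sup>2" using assms by (intro abs_le_square_iff[THEN iffD1]) auto
  then have "7 / 8 \<le> 1 + - t\<^sup>2 / 2" by (simp add: power2_eq_square)
  also have "\<dots> \<le> exp (- t\<^sup>2 / 2)" by (rule exp_ge_add_one_self)
  finally have "7 / 8 \<le> exp (- t\<^sup>2 / 2)" .
  moreover have "sqrt (2 * pi) \<le> 35 / 12"
    using pi_less_4 by (intro real_le_lsqrt) (auto simp: power2_eq_square)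
  then have "1 / (35 / 12) \<le> 1 / sqrt (2 * pi)" by (intro divide_left_mono) auto
  ultimately have "1 / (35 / 12) * (7 / 8) \<le> 1 / sqrt (2 * pi) * exp (- t\<^sup>2 / 2)"
    by (intro mult_mono) auto
  then show ?thesis by (simp add: std_normal_density_def)
qed

lemma std_normal_density_antimono:
  assumes "\<bar>s\<bar> \<le> \<bar>t\<bar>"
  shows "std_normal_density t \<le> std_normal_density s"
proof -
  have "s\<^sup>2 \<le> t\<^sup>2" using assms by (simp add: abs_le_square_iff)
  then show ?thesis by (auto simp: std_normal_density_def intro!: divide_right_mono)
qed

interpretation std_normal: prob_space std_normal
  by (rule prob_space_std_normal)

lemma emeasure_std_normal_le:
  assumes [measurable]: "A \<in> sets borel"
  shows "emeasure std_normal A \<le> ennreal (5 / 12) * emeasure lborel A"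
proof -
  have "emeasure std_normal A = (\<integral>\<^sup>+t. ennreal (std_normal_density t) * indicator A t \<partial>lborel)"
    by (simp add: emeasure_density)
  also have "\<dots> \<le> (\<integral>\<^sup>+t. ennreal (5 / 12) * indicator A t \<partial>lborel)"
    by (intro nn_integral_mono mult_right_mono ennreal_leI std_normal_density_le) auto
  also have "\<dots> = ennreal (5 / 12) * emeasure lborel A" by (simp add: nn_integral_cmult_indicator)
  finally show ?thesis .
qed

lemma emeasure_std_normal_Ioc_le:
  assumes "a \<le> b"
  shows "emeasure std_normal {a<..b} \<le> ennreal (5 / 12 * (b - a))"
  using emeasure_std_normal_le[of "{a<..b}"] assms by (simp flip: ennreal_mult)

lemma prob_std_normal_Ioc_ge:
  assumes "a \<le> b" "- 1 / 2 \<le> a" "b \<le> 1 / 2"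
  shows "3 / 10 * (b - a) \<le> measure std_normal {a<..b}"
proof -
  have "ennreal (3 / 10 * (b - a)) = (\<integral>\<^sup>+t. ennreal (3 / 10) * indicator {a<..b} t \<partial>lborel)"
    using assms(1) by (simp add: nn_integral_cmult_indicator flip: ennreal_mult)
  also have "\<dots> \<le> (\<integral>\<^sup>+t. ennreal (std_normal_density t) * indicator {a<..b} t \<partial>lborel)"
    using assms std_normal_density_ge
    by (intro nn_integral_mono) (auto intro!: ennreal_leI split: split_indicator simp: abs_le_iff)
  also have "\<dots> = emeasure std_normal {a<..b}" by (simp add: emeasure_density)
  finally show ?thesis by (simp add: std_normal.emeasure_eq_measure)
qed

lemma prob_std_normal_tail_ge:
  assumes "0 \<le> b"
  shows "1 / 2 - 5 / 12 * b \<le> measure std_normal {b<..}"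
proof -
  have "emeasure std_normal {0<..} = (\<integral>\<^sup>+t. ennreal (std_normal_density t) * indicator {0<..} t \<partial>lborel)"
    by (simp add: emeasure_density)
  also have "\<dots> = (\<integral>\<^sup>+t. ennreal (std_normal_density t) * indicator {..<0} t \<partial>lborel)"
    by (subst nn_integral_real_affine[where c = "-1" and t = 0])
      (auto intro!: nn_integral_cong simp: std_normal_density_def split: split_indicator)
  also have "\<dots> = emeasure std_normal {..<0}" by (simp add: emeasure_density)
  finally have sym: "measure std_normal {0<..} = measure std_normal {..<0}" by (simp add: measure_def)
  have "emeasure std_normal {0} = 0" using emeasure_std_normal_le[of "{0}"] by simp
  then have zero: "measure std_normal {0} = 0" by (simp add: measure_def)
  have "1 = measure std_normal (({..<0} \<union> {0}) \<union> {0<..})"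
  proof -
    have "({..<0} \<union> {0}) \<union> {0<..} = (UNIV :: real set)" by auto
    then show ?thesis using std_normal.prob_space by simp
  qed
  also have "\<dots> = measure std_normal {..<0} + measure std_normal {0} + measure std_normal {0<..}"
    by (subst std_normal.finite_measure_Union, simp, simp, force)+ simp
  finally have "measure std_normal {0<..} = 1 / 2" using sym zero by simp
  moreover have "measure std_normal ({0<..b} \<union> {b<..}) = measure std_normal {0<..b} + measure std_normal {b<..}"
    by (rule std_normal.finite_measure_Union) auto
  moreover have "{0<..b} \<union> {b<..} = {0<..}" using assms by auto
  moreover have "measure std_normal {0<..b} \<le> 5 / 12 * b"
    using emeasure_std_normal_Ioc_le[OF assms] assms by (simp add: std_normal.emeasure_eq_measure)
  ultimately show ?thesis by simp
qed

text \<open>The left-hand side is the total variation distance of the standard normal law and its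
  translate by \<open>- s\<close>. The positive part lives on \<open>t > - s / 2\<close>, where the point \<open>t\<close> is closer to 0
  than \<open>t + s\<close>, and translating the second term there leaves the normal mass of
  \<open>(- s / 2, s / 2]\<close>.\<close>

lemma nn_integral_std_normal_excess:
  assumes s: "0 \<le> s"
  shows "(\<integral>\<^sup>+t. ennreal (std_normal_density t - std_normal_density (t + s)) \<partial>lborel)
    \<le> ennreal (5 / 12 * s)"
proof -
  let ?A = "{- s / 2<..}" and ?B = "{s / 2<..}"
  let ?X = "\<integral>\<^sup>+t. ennreal (std_normal_density t - std_normal_density (t + s)) \<partial>lborel"
  have pointwise: "ennreal (std_normal_density t - std_normal_density (t + s))
      + ennreal (std_normal_density (t + s)) * indicator ?A t
      = ennreal (std_normal_density t) * indicator ?A t" for t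
  proof (cases "- s / 2 < t")
    case True
    then have "std_normal_density (t + s) \<le> std_normal_density t"
      using s by (intro std_normal_density_antimono) auto
    then show ?thesis using True by (simp flip: ennreal_plus)
  next
    case False
    then have "std_normal_density t \<le> std_normal_density (t + s)"
      using s by (intro std_normal_density_antimono) auto
    then show ?thesis using False by (simp add: ennreal_neg)
  qed
  have "(\<integral>\<^sup>+t. ennreal (std_normal_density (t + s)) * indicator ?A t \<partial>lborel)
      = (\<integral>\<^sup>+t. ennreal (std_normal_density (t + s)) * indicator ?B (t + s) \<partial>lborel)"
    by (intro nn_integral_cong) (auto split: split_indicator)
  also have "\<dots> = emeasure std_normal ?B"
    using nn_integral_lborel_shift[of "\<lambda>t. ennreal (std_normal_density t) * indicator ?B t" s]
    by (simp add: emeasure_density)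
  finally have shift: "(\<integral>\<^sup>+t. ennreal (std_normal_density (t + s)) * indicator ?A t \<partial>lborel)
      = emeasure std_normal ?B" .
  have "?X + emeasure std_normal ?B = (\<integral>\<^sup>+t. ennreal (std_normal_density t - std_normal_density (t + s))
      + ennreal (std_normal_density (t + s)) * indicator ?A t \<partial>lborel)"
    unfolding shift[symmetric] by (rule nn_integral_add[symmetric]) auto
  also have "\<dots> = emeasure std_normal ?A" by (simp only: pointwise) (simp add: emeasure_density)
  also have "?A = {- s / 2<..s / 2} \<union> ?B" using s by auto
  also have "emeasure std_normal \<dots> = emeasure std_normal {- s / 2<..s / 2} + emeasure std_normal ?B"
    by (intro plus_emeasure[symmetric]) auto
  finally have "?X = emeasure std_normal {- s / 2<..s / 2}"
    by (simp add: ennreal_add_left_cancel add.commute[of _ "emeasure std_normal ?B"])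
  then show ?thesis using emeasure_std_normal_Ioc_le[of "- s / 2" "s / 2"] s by simp
qed

section \<open>The coupled velocities\<close>

definition uniform01 :: "real measure" where
  "uniform01 = uniform_measure lborel {0..1}"

lemma sets_uniform01 [simp, measurable_cong]: "sets uniform01 = sets borel"
  by (simp add: uniform01_def)

lemma space_uniform01 [simp]: "space uniform01 = UNIV"
  by (simp add: uniform01_def)

lemma prob_space_uniform01: "prob_space uniform01"
  unfolding uniform01_def by (rule prob_space_uniform_measure) auto

lemma nn_integral_uniform01_threshold:
  assumes r: "0 \<le> r"
  shows "(\<integral>\<^sup>+u. (if u \<le> r then a else b) \<partial>uniform01) = ennreal (min 1 r) * a + ennreal (1 - r) * b"
proof -
  have "(\<integral>\<^sup>+u. (if u \<le> r then a else b) \<partial>uniform01)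
      = (\<integral>\<^sup>+u. a * indicator {..r} u + b * indicator {r<..} u \<partial>uniform01)"
    by (intro nn_integral_cong) auto
  also have "\<dots> = a * emeasure uniform01 {..r} + b * emeasure uniform01 {r<..}"
    by (subst nn_integral_add) (auto simp: nn_integral_cmult_indicator)
  also have "emeasure uniform01 {..r} = ennreal (min 1 r)"
  proof -
    have "{0..1} \<inter> {..r} = {0..min 1 r}" by auto
    then show ?thesis using r by (simp add: uniform01_def divide_ennreal_def)
  qed
  also have "emeasure uniform01 {r<..} = ennreal (1 - r)"
  proof (cases "r \<le> 1")
    case True
    have "{0..1} \<inter> {r<..} = {r<..1}" using r by auto
    then show ?thesis using True by (simp add: uniform01_def divide_ennreal_def)
  next
    case False
    then have "{0..1} \<inter> {r<..} = {}" by auto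
    then show ?thesis using False by (simp add: uniform01_def ennreal_neg)
  qed
  finally show ?thesis by (simp add: mult.commute)
qed

definition density_ratio :: "'a::euclidean_space \<Rightarrow> real \<Rightarrow> 'a \<Rightarrow> real" where
  "density_ratio e s v = std_normal_density (e \<bullet> v + s) / std_normal_density (e \<bullet> v)"

text \<open>For a standard normal vector \<open>v\<close>, a unit vector \<open>e\<close> and a uniform threshold \<open>u\<close> this is
  again a standard normal vector, and it equals \<open>v + s e\<close> as often as possible (a maximal coupling
  with \<open>v + s e\<close>); otherwise it is the mirror image of \<open>v\<close>.\<close>

definition mirror_velocity :: "'a::euclidean_space \<Rightarrow> real \<Rightarrow> 'a \<Rightarrow> real \<Rightarrow> 'a" where
  "mirror_velocity e s v u =
     (if u \<le> density_ratio e s v then v + s *\<^sub>R e else reflection e v)"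

lemma density_ratio_nonneg: "0 \<le> density_ratio e s v"
  by (simp add: density_ratio_def)

lemma density_ratio_measurable [measurable]: "density_ratio e s \<in> borel_measurable borel"
  unfolding density_ratio_def by measurable

lemma mirror_velocity_measurable [measurable]:
  "(\<lambda>x. mirror_velocity e s (fst x) (snd x)) \<in> borel_measurable (borel \<Otimes>\<^sub>M borel)"
  unfolding mirror_velocity_def by measurable

text \<open>Only the component in the direction of the shift contributes to the ratio of the Gaussian
  densities; for this reason an acceptance test with one-dimensional densities is enough.\<close>

lemma gauss_density_shift:
  assumes "norm e = 1"
  shows "gauss_density (v + s *\<^sub>R e) = gauss_density v * density_ratio e s v"
proof -
  have "(norm (v + s *\<^sub>R e))\<^sup>2 = (norm v)\<^sup>2 + ((e \<bullet> v + s)\<^sup>2 - (e \<bullet> v)\<^sup>2)"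
    using assms unfolding power2_norm_eq_inner
    by (simp add: inner_simps norm_eq_1 inner_commute power2_eq_square algebra_simps)
  then have "- (norm (v + s *\<^sub>R e))\<^sup>2 / 2 = - (norm v)\<^sup>2 / 2 + (- (e \<bullet> v + s)\<^sup>2 / 2 - - (e \<bullet> v)\<^sup>2 / 2)"
    by simp
  then show ?thesis
    by (simp only: gauss_density_def density_ratio_def std_normal_density_def exp_add exp_diff) simp
qed

lemma gauss_density_reflection: "norm e = 1 \<Longrightarrow> gauss_density (reflection e v) = gauss_density v"
  by (simp add: gauss_density_def orthogonal_transformation_norm[OF reflection_orthogonal])

lemma nn_integral_mirror:
  fixes f g :: "'a::euclidean_space \<Rightarrow> ennreal"
  assumes [measurable]: "f \<in> borel_measurable borel" "g \<in> borel_measurable borel"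
  shows "(\<integral>\<^sup>+x. (if snd x \<le> density_ratio e s (fst x) then f (fst x) else g (fst x))
      \<partial>(std_gaussian \<Otimes>\<^sub>M uniform01)) =
    (\<integral>\<^sup>+v. ennreal (min 1 (density_ratio e s v)) * f v + ennreal (1 - density_ratio e s v) * g v
      \<partial>std_gaussian)"
proof -
  interpret U: prob_space uniform01 by (rule prob_space_uniform01)
  show ?thesis
    by (subst U.nn_integral_fst[symmetric])
      (simp_all only: fst_conv snd_conv nn_integral_uniform01_threshold density_ratio_nonneg, simp)
qed

text \<open>Writing \<open>\<phi>\<close> for the Gaussian density, accepted translations contribute
  \<open>min (\<phi> (y - s e)) (\<phi> y)\<close> to the density at \<open>y\<close>. Reflections contribute the positive part of
  \<open>\<phi> v - \<phi> (v + s e)\<close> at the mirror image \<open>v\<close> of \<open>y\<close>, which is the positive part of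
  \<open>\<phi> y - \<phi> (y - s e)\<close>. The two add up to \<open>\<phi> y\<close>.\<close>

lemma distr_mirror_velocity:
  fixes e :: "'a::euclidean_space"
  assumes e: "norm e = 1"
  shows "distr (std_gaussian \<Otimes>\<^sub>M uniform01) borel (\<lambda>x. mirror_velocity e s (fst x) (snd x)) = std_gaussian"
proof (rule measure_eqI)
  let ?P = "std_gaussian \<Otimes>\<^sub>M uniform01 :: ('a \<times> real) measure"
  let ?\<phi> = "gauss_density :: 'a \<Rightarrow> real"
  have ee: "e \<bullet> e = 1" using e by (simp add: norm_eq_1)
  fix A :: "'a set"
  assume "A \<in> sets (distr ?P borel (\<lambda>x. mirror_velocity e s (fst x) (snd x)))"
  then have [measurable]: "A \<in> sets borel" by simp
  define m where "m v = ennreal (min (?\<phi> v) (?\<phi> (v + s *\<^sub>R e)))" for v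
  define d where "d v = ennreal (?\<phi> v - ?\<phi> (v + s *\<^sub>R e))" for v
  have [measurable]: "m \<in> borel_measurable borel" "d \<in> borel_measurable borel"
    unfolding m_def d_def by measurable
  have m: "ennreal (?\<phi> v) * ennreal (min 1 (density_ratio e s v)) = m v" for v
    using gauss_density_pos[of v] density_ratio_nonneg[of e s v]
    by (simp add: m_def gauss_density_shift[OF e] min_def flip: ennreal_mult)
  have d: "ennreal (?\<phi> v) * ennreal (1 - density_ratio e s v) = d v" for v
    using gauss_density_pos[of v]
    by (simp add: d_def gauss_density_shift[OF e] algebra_simps flip: ennreal_mult')
  have "emeasure (distr ?P borel (\<lambda>x. mirror_velocity e s (fst x) (snd x))) A
      = (\<integral>\<^sup>+x. (if snd x \<le> density_ratio e s (fst x) then indicator A (fst x + s *\<^sub>R e)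
          else indicator A (reflection e (fst x))) \<partial>?P)"
    by (auto simp: emeasure_distr_nn_integral mirror_velocity_def intro!: nn_integral_cong)
  also have "\<dots> = (\<integral>\<^sup>+v. m v * indicator A (v + s *\<^sub>R e) + d v * indicator A (reflection e v) \<partial>lborel)"
    by (subst nn_integral_mirror)
      (auto simp: std_gaussian_eq nn_integral_density distrib_left m d simp flip: mult.assoc)
  also have "\<dots> = (\<integral>\<^sup>+v. m v * indicator A (v + s *\<^sub>R e) \<partial>lborel)
      + (\<integral>\<^sup>+v. d v * indicator A (reflection e v) \<partial>lborel)"
    by (rule nn_integral_add) auto
  also have "(\<integral>\<^sup>+v. m v * indicator A (v + s *\<^sub>R e) \<partial>lborel) = (\<integral>\<^sup>+v. m (v - s *\<^sub>R e) * indicator A v \<partial>lborel)"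
    using nn_integral_lborel_shift[of "\<lambda>v. m (v - s *\<^sub>R e) * indicator A v" "s *\<^sub>R e"] by simp
  also have "(\<integral>\<^sup>+v. d v * indicator A (reflection e v) \<partial>lborel)
      = (\<integral>\<^sup>+v. d (reflection e v) * indicator A v \<partial>distr lborel borel (reflection e))"
    by (simp add: nn_integral_distr reflection_involution[OF e])
  also have "\<dots> = (\<integral>\<^sup>+v. d (reflection e v) * indicator A v \<partial>lborel)"
    by (simp add: distr_lborel_orthogonal reflection_orthogonal e)
  also have "(\<integral>\<^sup>+v. m (v - s *\<^sub>R e) * indicator A v \<partial>lborel) + \<dots>
      = (\<integral>\<^sup>+v. m (v - s *\<^sub>R e) * indicator A v + d (reflection e v) * indicator A v \<partial>lborel)"
    by (rule nn_integral_add[symmetric]) auto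
  also have "\<dots> = (\<integral>\<^sup>+v. ennreal (?\<phi> v) * indicator A v \<partial>lborel)"
  proof (rule nn_integral_cong)
    fix v
    have "reflection e v + s *\<^sub>R e = reflection e (v - s *\<^sub>R e)"
      by (simp add: reflection_def inner_simps ee algebra_simps) (simp flip: scaleR_add_left)
    then have "?\<phi> (reflection e v + s *\<^sub>R e) = ?\<phi> (v - s *\<^sub>R e)"
      by (simp add: gauss_density_reflection[OF e])
    then have "d (reflection e v) = ennreal (?\<phi> v - ?\<phi> (v - s *\<^sub>R e))"
      by (simp add: d_def gauss_density_reflection[OF e])
    then have "m (v - s *\<^sub>R e) + d (reflection e v) = ennreal (?\<phi> v)"
      using gauss_density_pos[of v] gauss_density_pos[of "v - s *\<^sub>R e"]
      by (cases "?\<phi> v \<le> ?\<phi> (v - s *\<^sub>R e)") (simp_all add: m_def min_def ennreal_neg flip: ennreal_plus)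
    then show "m (v - s *\<^sub>R e) * indicator A v + d (reflection e v) * indicator A v
        = ennreal (?\<phi> v) * indicator A v"
      by (simp flip: distrib_right)
  qed
  also have "\<dots> = emeasure std_gaussian A" by (simp add: std_gaussian_eq emeasure_density)
  finally show "emeasure (distr ?P borel (\<lambda>x. mirror_velocity e s (fst x) (snd x))) A
      = emeasure std_gaussian A" .
qed simp

lemma reflection_probability_le:
  fixes e :: "'a::euclidean_space"
  assumes e: "norm e = 1" and s: "0 \<le> s"
  shows "emeasure (std_gaussian \<Otimes>\<^sub>M uniform01) {x. \<not> snd x \<le> density_ratio e s (fst x)}
    \<le> ennreal (5 / 12 * s)"
proof -
  let ?P = "std_gaussian \<Otimes>\<^sub>M uniform01 :: ('a \<times> real) measure"
  let ?r = "\<lambda>t. std_normal_density (t + s) / std_normal_density t"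
  have pos: "0 < std_normal_density t" for t by (simp add: normal_density_pos)
  have "Measurable.pred ?P (\<lambda>x. \<not> snd x \<le> density_ratio e s (fst x))" by measurable
  then have [measurable]: "{x. \<not> snd x \<le> density_ratio e s (fst x)} \<in> sets ?P"
    by (simp add: pred_def space_pair_measure)
  have "emeasure ?P {x. \<not> snd x \<le> density_ratio e s (fst x)}
      = (\<integral>\<^sup>+x. indicator {x. \<not> snd x \<le> density_ratio e s (fst x)} x \<partial>?P)"
    by (rule nn_integral_indicator[symmetric]) measurable
  also have "\<dots> = (\<integral>\<^sup>+x. (if snd x \<le> density_ratio e s (fst x) then 0 else 1) \<partial>?P)"
    by (intro nn_integral_cong) auto
  also have "\<dots> = (\<integral>\<^sup>+v. ennreal (1 - density_ratio e s v) \<partial>std_gaussian)"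
    by (subst nn_integral_mirror) auto
  also have "\<dots> = (\<integral>\<^sup>+t. ennreal (1 - ?r t) \<partial>distr std_gaussian borel (\<lambda>v. e \<bullet> v))"
    by (simp add: nn_integral_distr density_ratio_def)
  also have "\<dots> = (\<integral>\<^sup>+t. ennreal (std_normal_density t) * ennreal (1 - ?r t) \<partial>lborel)"
    by (simp add: distr_std_gaussian_inner[OF e] nn_integral_density)
  also have "\<dots> = (\<integral>\<^sup>+t. ennreal (std_normal_density t - std_normal_density (t + s)) \<partial>lborel)"
  proof (rule nn_integral_cong)
    fix t
    have "std_normal_density t * (1 - ?r t) = std_normal_density t - std_normal_density (t + s)"
      using pos[of t] by (simp add: field_simps)
    then show "ennreal (std_normal_density t) * ennreal (1 - ?r t)
        = ennreal (std_normal_density t - std_normal_density (t + s))"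
      by (simp flip: ennreal_mult')
  qed
  also have "\<dots> \<le> ennreal (5 / 12 * s)" by (rule nn_integral_std_normal_excess[OF s])
  finally show ?thesis .
qed

section \<open>The concave distance\<close>

text \<open>This is the concave distance function \<open>\<lambda>r. \<integral>\<^sub>0\<^sup>r exp (- s / T) ds\<close> without the modification
  beyond \<open>R\<^sub>1\<close>; the latter is invisible to the semimetric, whose distances are capped at
  \<open>2 R < R\<^sub>1\<close>.\<close>

definition saturating :: "real \<Rightarrow> real \<Rightarrow> real" where
  "saturating T r = T * (1 - exp (- r / T))"

lemma f_metric_eq_saturating:
  assumes T: "0 < T" and r: "0 \<le> r" "r \<le> R1"
  shows "f_metric (1 / T) R1 r = saturating T r"
proof -
  have "f_metric (1 / T) R1 r = integral {0..r} (\<lambda>s. exp (- s / T))"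
    unfolding f_metric_def using r by (intro integral_cong) (auto simp: min_def)
  also have "((\<lambda>s. exp (- s / T)) has_integral (- T * exp (- r / T) - - T * exp (- 0 / T))) {0..r}"
    using T r(1) by (intro fundamental_theorem_of_calculus)
      (auto intro!: derivative_eq_intros simp: has_real_derivative_iff_has_vector_derivative[symmetric])
  then have "integral {0..r} (\<lambda>s. exp (- s / T)) = saturating T r"
    by (auto simp: saturating_def algebra_simps dest: integral_unique)
  finally show ?thesis .
qed

lemma rho_eq_saturating:
  assumes "0 < T" "0 \<le> R" "2 * R \<le> R1"
  shows "rho (1 / T) R1 R \<epsilon> \<Psi> x y
    = sqrt (saturating T (min (norm (x - y)) (2 * R)) * (1 + \<epsilon> * \<Psi> x + \<epsilon> * \<Psi> y))"
  using assms by (simp add: rho_def f_metric_eq_saturating)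

lemma saturating_mono: "0 < T \<Longrightarrow> r \<le> s \<Longrightarrow> saturating T r \<le> saturating T s"
  by (simp add: saturating_def divide_right_mono)

lemma saturating_nonneg: "0 < T \<Longrightarrow> 0 \<le> r \<Longrightarrow> 0 \<le> saturating T r"
  by (simp add: saturating_def)

lemma saturating_pos: "0 < T \<Longrightarrow> 0 < r \<Longrightarrow> 0 < saturating T r"
  by (simp add: saturating_def)

lemma saturating_le_tangent:
  assumes T: "0 < T"
  shows "saturating T s \<le> saturating T r + exp (- r / T) * (s - r)"
proof -
  have "exp (- r / T) * (1 + (r - s) / T) \<le> exp (- r / T) * exp ((r - s) / T)"
    by (intro mult_left_mono exp_ge_add_one_self) auto
  also have "\<dots> = exp (- s / T)" by (simp add: diff_divide_distrib flip: exp_add)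
  finally have "T * (exp (- r / T) * (1 + (r - s) / T)) \<le> T * exp (- s / T)"
    using T by (intro mult_left_mono) auto
  moreover have "T * (exp (- r / T) * (1 + (r - s) / T)) = exp (- r / T) * (T + (r - s))"
    using T by (simp add: field_simps)
  ultimately show ?thesis by (simp add: saturating_def algebra_simps)
qed

text \<open>No matter how far the two points are driven apart, the increase is at most the mass of the
  tail \<open>\<integral>\<^sub>r\<^sup>\<infinity> exp (- s / T) ds\<close>.\<close>

lemma saturating_le_add:
  assumes "0 < T"
  shows "saturating T s \<le> saturating T r + T * exp (- r / T)"
  using assms by (simp add: saturating_def algebra_simps)

text \<open>The function \<open>(exp u - 1) / u\<close> is increasing, so that the relative gain
  \<open>r exp (- r / T) / saturating T r\<close> is smallest at \<open>r = 2 R\<close>.\<close>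

lemma saturating_le_rate:
  fixes r R T :: real
  assumes T: "0 < T" and r: "0 < r" "r \<le> 2 * R"
  shows "exp (- 2 * R / T) * (1 - exp (- r / T)) \<le> 2 * min (1 / T) (1 / R / 4) * r * exp (- r / T)"
proof (cases "1 / T \<le> 1 / R / 4")
  case True
  have "exp (- 2 * R / T) * (1 - exp (- r / T)) \<le> exp (- r / T) * (r / T)"
    using T r exp_ge_add_one_self[of "- r / T"]
    by (intro mult_mono) (auto simp: divide_right_mono)
  also have "\<dots> \<le> exp (- r / T) * (2 * (1 / T) * r)"
    using T r by (intro mult_left_mono) (auto simp: divide_right_mono)
  finally show ?thesis using True by (simp add: min_def algebra_simps)
next
  case False
  have R: "0 < R" using r by simp
  define t where "t = r / (2 * R)"
  have t: "0 \<le> t" "t \<le> 1" using r R by (auto simp: t_def)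
  have "exp ((1 - t) *\<^sub>R 0 + t *\<^sub>R (2 * R / T)) \<le> (1 - t) * exp 0 + t * exp (2 * R / T)"
    using t by (intro convex_onD[OF exp_convex]) auto
  moreover have "t * (2 * R) = r" using R by (simp add: t_def)
  ultimately have "exp (r / T) - 1 \<le> t * exp (2 * R / T)" using t(1) by simp
  then have "exp (- 2 * R / T) * exp (- r / T) * (exp (r / T) - 1)
      \<le> exp (- 2 * R / T) * exp (- r / T) * (t * exp (2 * R / T))"
    by (intro mult_left_mono) auto
  then have "exp (- 2 * R / T) * (1 - exp (- r / T)) \<le> t * exp (- r / T)"
    by (simp add: algebra_simps flip: exp_add)
  then show ?thesis using False R by (simp add: min_def t_def)
qed

section \<open>From distance and weight to the semimetric\<close>

text \<open>This is the Cauchy--Schwarz inequality for the square roots. It is obtained from the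
  inequality of arithmetic and geometric means for \<open>t F\<close> and \<open>G / t\<close> with the optimal \<open>t\<close>, which
  gives integrability along the way.\<close>

lemma (in prob_space) expectation_sqrt_mult_le:
  fixes F G :: "'a \<Rightarrow> real"
  assumes F: "integrable M F" "\<And>\<omega>. 0 \<le> F \<omega>" "expectation F \<le> A" "0 < A"
    and G: "integrable M G" "\<And>\<omega>. 0 \<le> G \<omega>" "expectation G \<le> B" "0 < B"
  shows "integrable M (\<lambda>\<omega>. sqrt (F \<omega> * G \<omega>))"
    and "expectation (\<lambda>\<omega>. sqrt (F \<omega> * G \<omega>)) \<le> sqrt (A * B)"
proof -
  define t where "t = sqrt (B / A)"
  have t: "0 < t" "t * A = sqrt (A * B)" "B / t = sqrt (A * B)"
  proof -
    show "0 < t" using F(4) G(4) by (simp add: t_def)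
    have "A = sqrt A * sqrt A" "B = sqrt B * sqrt B" using F(4) G(4) by auto
    then show "t * A = sqrt (A * B)" "B / t = sqrt (A * B)"
      using F(4) G(4) unfolding t_def real_sqrt_divide real_sqrt_mult by (auto simp: field_simps)
  qed
  have le: "sqrt (F \<omega> * G \<omega>) \<le> (t * F \<omega> + G \<omega> / t) / 2" for \<omega>
    using arith_geo_mean_sqrt[of "t * F \<omega>" "G \<omega> / t"] F(2) G(2) t(1) by simp
  have int: "integrable M (\<lambda>\<omega>. (t * F \<omega> + G \<omega> / t) / 2)" using F(1) G(1) by auto
  have [measurable]: "F \<in> borel_measurable M" "G \<in> borel_measurable M" using F(1) G(1) by auto
  show I: "integrable M (\<lambda>\<omega>. sqrt (F \<omega> * G \<omega>))"
    using le F(2) G(2) t(1) by (intro Bochner_Integration.integrable_bound[OF int]) auto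
  have "expectation (\<lambda>\<omega>. sqrt (F \<omega> * G \<omega>)) \<le> expectation (\<lambda>\<omega>. (t * F \<omega> + G \<omega> / t) / 2)"
    by (rule integral_mono[OF I int le])
  also have "\<dots> = (t * expectation F + expectation G / t) / 2" using F(1) G(1) by simp
  also have "\<dots> \<le> (t * A + B / t) / 2"
    using F(3) G(3) t(1) by (intro divide_right_mono add_mono mult_left_mono) auto
  also have "\<dots> = sqrt (A * B)" using t by simp
  finally show "expectation (\<lambda>\<omega>. sqrt (F \<omega> * G \<omega>)) \<le> sqrt (A * B)" .
qed

lemma (in prob_space) integrable_saturating:
  assumes T: "0 < T" and R: "0 \<le> R" and [measurable]: "D \<in> borel_measurable M"
    and D0: "\<And>\<omega>. 0 \<le> D \<omega>"
  shows "integrable M (\<lambda>\<omega>. saturating T (min (D \<omega>) (2 * R)))"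
proof -
  have [measurable]: "(\<lambda>\<omega>. saturating T (min (D \<omega>) (2 * R))) \<in> borel_measurable M"
    unfolding saturating_def by measurable
  show ?thesis
    using T R D0 by (intro integrable_const_bound[where B = T] AE_I2)
      (auto simp: saturating_def abs_mult mult_le_cancel_left1 abs_le_iff)
qed

text \<open>Here \<open>A\<close> is the event that the velocity is reflected. Off \<open>A\<close> the distance contracts and
  concavity yields a gain of \<open>3 / 4 \<gamma> T r exp (- r / T)\<close>. On \<open>A\<close> nothing is known about the new
  distance, but the loss is at most \<open>T exp (- r / T)\<close>, and \<open>A\<close> has a probability of at most
  \<open>5 / 12 \<gamma> r \<le> 5 / 24\<close>. Since gain and loss carry the same factor
  \<open>\<gamma> r T exp (- r / T)\<close>, the gain prevails by \<open>3 / 4 (1 - 5 / 24) - 5 / 12 > 3 / 20\<close>.\<close>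

lemma (in prob_space) expectation_saturating_le:
  assumes T: "0 < T" and r: "0 < r" "r < 2 * R"
    and \<gamma>: "\<gamma> = min (1 / T) (1 / R / 4)"
    and D [measurable]: "D \<in> borel_measurable M"
    and A: "A \<in> events" "prob A \<le> 5 / 12 * (\<gamma> * r)"
    and contract: "\<And>\<omega>. \<omega> \<in> space M \<Longrightarrow> \<omega> \<notin> A \<Longrightarrow> D \<omega> \<le> (1 - 3 / 4 * (\<gamma> * T)) * r"
    and D0: "\<And>\<omega>. 0 \<le> D \<omega>"
  shows "expectation (\<lambda>\<omega>. saturating T (min (D \<omega>) (2 * R)))
      \<le> (1 - 3 / 40 * exp (- 2 * R / T)) * saturating T r"
proof -
  let ?F = "\<lambda>\<omega>. saturating T (min (D \<omega>) (2 * R))"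
  let ?e = "exp (- r / T)"
  define g where "g = \<gamma> * r"
  have R: "0 < R" using r by simp
  have \<gamma>0: "0 < \<gamma>" using T R by (simp add: \<gamma>)
  have "g \<le> 1 / R / 4 * (2 * R)" using r \<gamma>0 unfolding g_def by (intro mult_mono) (auto simp: \<gamma>)
  then have g: "0 < g" "g \<le> 1 / 2" using R \<gamma>0 r by (auto simp: g_def)
  have int: "integrable M ?F" using R by (intro integrable_saturating T D D0) auto
  have le: "?F \<omega> \<le> (saturating T r - 3 / 4 * (T * g * ?e)) + (T * ?e + 3 / 4 * (T * g * ?e)) * indicator A \<omega>"
    if "\<omega> \<in> space M" for \<omega>
  proof (cases "\<omega> \<in> A")
    case True
    then show ?thesis using saturating_le_add[OF T, of "min (D \<omega>) (2 * R)" r] by simp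
  next
    case False
    have "?F \<omega> \<le> saturating T ((1 - 3 / 4 * (\<gamma> * T)) * r)"
      using contract[OF that False] by (intro saturating_mono[OF T]) auto
    also have "\<dots> \<le> saturating T r + ?e * ((1 - 3 / 4 * (\<gamma> * T)) * r - r)"
      by (rule saturating_le_tangent[OF T])
    also have "\<dots> = saturating T r - 3 / 4 * (T * g * ?e)" by (simp add: g_def algebra_simps)
    finally show ?thesis using False by simp
  qed
  have ind: "integrable M (indicat_real A)"
    using A(1) by (intro integrable_const_bound[where B = 1]) auto
  have "expectation ?F \<le> expectation (\<lambda>\<omega>. (saturating T r - 3 / 4 * (T * g * ?e))
      + (T * ?e + 3 / 4 * (T * g * ?e)) * indicator A \<omega>)"
    using ind by (intro integral_mono int le) auto
  also have "\<dots> = (saturating T r - 3 / 4 * (T * g * ?e)) + (T * ?e + 3 / 4 * (T * g * ?e)) * prob A"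
    using ind A(1) by (simp add: prob_space)
  also have "\<dots> \<le> (saturating T r - 3 / 4 * (T * g * ?e)) + (T * ?e + 3 / 4 * (T * g * ?e)) * (5 / 12 * g)"
    using A(2) T g by (intro add_left_mono mult_left_mono) (auto simp: g_def)
  also have "\<dots> \<le> saturating T r - 3 / 20 * (T * g * ?e)"
  proof -
    have "(T * g * ?e) * g \<le> (T * g * ?e) * (1 / 2)" using T g by (intro mult_left_mono) auto
    moreover have "0 \<le> T * g * ?e" using T g by simp
    ultimately show ?thesis by (simp add: algebra_simps)
  qed
  also have "\<dots> \<le> (1 - 3 / 40 * exp (- 2 * R / T)) * saturating T r"
  proof -
    have "exp (- 2 * R / T) * (1 - ?e) \<le> 2 * g * ?e"
      using saturating_le_rate[OF T, of r R] r by (simp add: g_def \<gamma> mult.assoc)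
    then have "T * (exp (- 2 * R / T) * (1 - ?e)) \<le> T * (2 * g * ?e)" using T by (intro mult_left_mono) auto
    then show ?thesis unfolding saturating_def by (simp add: algebra_simps)
  qed
  finally show "expectation ?F \<le> (1 - 3 / 40 * exp (- 2 * R / T)) * saturating T r" .
qed

text \<open>The semimetric is the geometric mean of a bounded distance and the weight
  \<open>1 + \<epsilon> \<Psi> x + \<epsilon> \<Psi> y\<close>, and it suffices that the product of the two expectations contracts by
  \<open>1 - 2 c\<close>. For distant points the distance cannot grow, since it is capped, and the weight
  contracts: the drift yields \<open>\<lambda> \<epsilon> (\<Psi> x + \<Psi> y) \<ge> 4 \<epsilon> \<alpha>\<close>, which exceeds the error
  \<open>2 \<epsilon> \<alpha>\<close>. For points that are close the distance contracts by \<open>1 - 3 E / 40\<close> with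
  \<open>E = exp (- 2 R / T)\<close>, while the weight grows by at most \<open>1 + 2 \<epsilon> \<alpha> = 1 + E / 20\<close>.\<close>

lemma (in prob_space) semimetric_contraction:
  fixes X Y :: "'a \<Rightarrow> 'b::euclidean_space" and \<Psi> :: "'b \<Rightarrow> real"
  assumes T: "0 < T" and R: "0 < R" and lam: "0 < lam" and al: "0 < \<alpha>"
    and \<epsilon>: "\<epsilon> = 1 / (40 * \<alpha>) * exp (- 2 * R / T)"
    and c: "c = 1 / 80 * min (10 * lam) (exp (- 2 * R / T))"
    and XY [measurable]: "X \<in> borel_measurable M" "Y \<in> borel_measurable M"
    and \<Psi>0: "\<And>u. 0 \<le> \<Psi> u"
    and drift_X: "integrable M (\<lambda>\<omega>. \<Psi> (X \<omega>))" "expectation (\<lambda>\<omega>. \<Psi> (X \<omega>)) \<le> (1 - lam) * \<Psi> x + \<alpha>"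
    and drift_Y: "integrable M (\<lambda>\<omega>. \<Psi> (Y \<omega>))" "expectation (\<lambda>\<omega>. \<Psi> (Y \<omega>)) \<le> (1 - lam) * \<Psi> y + \<alpha>"
    and "x \<noteq> y"
    and far: "2 * R \<le> norm (x - y) \<Longrightarrow> 4 * \<alpha> / lam \<le> \<Psi> x + \<Psi> y"
    and near: "norm (x - y) < 2 * R \<Longrightarrow>
      expectation (\<lambda>\<omega>. saturating T (min (norm (X \<omega> - Y \<omega>)) (2 * R)))
        \<le> (1 - 3 / 40 * exp (- 2 * R / T)) * saturating T (norm (x - y))"
  shows "integrable M (\<lambda>\<omega>. sqrt (saturating T (min (norm (X \<omega> - Y \<omega>)) (2 * R))
          * (1 + \<epsilon> * \<Psi> (X \<omega>) + \<epsilon> * \<Psi> (Y \<omega>))))"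
    and "expectation (\<lambda>\<omega>. sqrt (saturating T (min (norm (X \<omega> - Y \<omega>)) (2 * R))
          * (1 + \<epsilon> * \<Psi> (X \<omega>) + \<epsilon> * \<Psi> (Y \<omega>))))
      \<le> (1 - c) * sqrt (saturating T (min (norm (x - y)) (2 * R)) * (1 + \<epsilon> * \<Psi> x + \<epsilon> * \<Psi> y))"
proof -
  let ?F = "\<lambda>\<omega>. saturating T (min (norm (X \<omega> - Y \<omega>)) (2 * R))"
  let ?G = "\<lambda>\<omega>. 1 + \<epsilon> * \<Psi> (X \<omega>) + \<epsilon> * \<Psi> (Y \<omega>)"
  let ?f = "saturating T (min (norm (x - y)) (2 * R))"
  define E where "E = exp (- 2 * R / T)"
  define S where "S = \<epsilon> * (\<Psi> x + \<Psi> y)"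
  define B where "B = 1 + E / 20 + (1 - lam) * S"
  have E: "0 < E" "E \<le> 1" using T R by (auto simp: E_def)
  have \<epsilon>0: "0 < \<epsilon>" "\<epsilon> * \<alpha> = E / 40" using E al by (auto simp: \<epsilon> E_def)
  have S: "0 \<le> S" using \<epsilon>0 \<Psi>0 by (simp add: S_def)
  have c_le: "0 < c" "2 * c \<le> lam / 4" "2 * c \<le> E / 40" using lam E by (auto simp: c E_def)
  have f0: "0 < ?f" using T R \<open>x \<noteq> y\<close> by (intro saturating_pos) auto
  have F: "integrable M ?F" "0 \<le> ?F \<omega>" for \<omega>
    using T R by (auto intro!: integrable_saturating saturating_nonneg)
  have G: "integrable M ?G" "1 \<le> ?G \<omega>" for \<omega> using drift_X drift_Y \<epsilon>0 \<Psi>0 by auto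
  have G0: "0 \<le> ?G \<omega>" for \<omega> using G(2)[of \<omega>] by linarith
  have "expectation ?G = 1 + \<epsilon> * expectation (\<lambda>\<omega>. \<Psi> (X \<omega>)) + \<epsilon> * expectation (\<lambda>\<omega>. \<Psi> (Y \<omega>))"
    using drift_X(1) drift_Y(1) by (simp add: prob_space)
  also have "\<dots> \<le> 1 + \<epsilon> * ((1 - lam) * \<Psi> x + \<alpha>) + \<epsilon> * ((1 - lam) * \<Psi> y + \<alpha>)"
    using drift_X(2) drift_Y(2) \<epsilon>0 by (intro add_mono mult_left_mono) auto
  also have "\<dots> = B" using \<epsilon>0(2) by (simp add: B_def S_def algebra_simps)
  finally have GB: "expectation ?G \<le> B" .
  have "1 \<le> expectation ?G"
    using integral_mono[of M "\<lambda>_. 1" ?G] G by (simp add: prob_space)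
  with GB have B0: "0 < B" by linarith
  obtain A where A: "0 < A" "expectation ?F \<le> A" "A * B \<le> (1 - 2 * c) * (?f * (1 + S))"
  proof (cases "2 * R \<le> norm (x - y)")
    case True
    show ?thesis
    proof (rule that[OF f0])
      have "expectation ?F \<le> expectation (\<lambda>_. saturating T (2 * R))"
        using F by (intro integral_mono saturating_mono T) auto
      then show "expectation ?F \<le> ?f" using True by (simp add: prob_space min_def)
      have "\<epsilon> * (4 * \<alpha> / lam) \<le> S"
        unfolding S_def using far[OF True] \<epsilon>0 by (intro mult_left_mono) auto
      then have "lam * (\<epsilon> * (4 * \<alpha> / lam)) \<le> lam * S" using lam by (intro mult_left_mono) auto
      then have "E / 10 \<le> lam * S" using \<epsilon>0(2) lam by simp
      moreover have "2 * c * S \<le> lam / 4 * S" using c_le S by (intro mult_right_mono) auto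
      ultimately have "B \<le> (1 - 2 * c) * (1 + S)"
        using c_le unfolding B_def by (simp add: algebra_simps)
      then have "?f * B \<le> ?f * ((1 - 2 * c) * (1 + S))" using f0 by (intro mult_left_mono) auto
      then show "?f * B \<le> (1 - 2 * c) * (?f * (1 + S))" by (simp add: algebra_simps)
    qed
  next
    case False
    then have f: "?f = saturating T (norm (x - y))" by (simp add: min_def)
    show ?thesis
    proof (rule that)
      show "0 < (1 - 3 / 40 * E) * ?f" using E f0 by simp
      show "expectation ?F \<le> (1 - 3 / 40 * E) * ?f" using near False by (simp add: f E_def)
      have "(1 - 3 / 40 * E) * B \<le> (1 - 3 / 40 * E) * (1 + E / 20 + S)"
        using E S lam unfolding B_def by (intro mult_left_mono) (auto simp: algebra_simps)
      also have "\<dots> \<le> (1 - E / 40) * (1 + S)"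
      proof -
        have "0 \<le> E * E" "0 \<le> E * S" using E S by auto
        then show ?thesis by (simp add: algebra_simps)
      qed
      also have "\<dots> \<le> (1 - 2 * c) * (1 + S)" using c_le S by (intro mult_right_mono) auto
      finally have "?f * ((1 - 3 / 40 * E) * B) \<le> ?f * ((1 - 2 * c) * (1 + S))"
        using f0 by (intro mult_left_mono) auto
      then show "(1 - 3 / 40 * E) * ?f * B \<le> (1 - 2 * c) * (?f * (1 + S))"
        by (simp add: algebra_simps)
    qed
  qed
  note * = expectation_sqrt_mult_le[OF F(1) F(2) A(2) A(1) G(1) G0 GB B0]
  show "integrable M (\<lambda>\<omega>. sqrt (?F \<omega> * ?G \<omega>))" by (rule *)
  have "A * B \<le> (1 - c)\<^sup>2 * (?f * (1 + S))"
  proof (rule order_trans[OF A(3)], rule mult_right_mono)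
    show "1 - 2 * c \<le> (1 - c)\<^sup>2" by (simp add: power2_eq_square algebra_simps)
    show "0 \<le> ?f * (1 + S)" using f0 S by simp
  qed
  then have "sqrt (A * B) \<le> sqrt ((1 - c)\<^sup>2 * (?f * (1 + S)))" by simp
  also have "\<dots> = (1 - c) * sqrt (?f * (1 + S))"
    using c_le E by (simp add: real_sqrt_mult)
  also have "1 + S = 1 + \<epsilon> * \<Psi> x + \<epsilon> * \<Psi> y" by (simp add: S_def algebra_simps)
  finally show "expectation (\<lambda>\<omega>. sqrt (?F \<omega> * ?G \<omega>)) \<le> (1 - c) * sqrt (?f * (1 + \<epsilon> * \<Psi> x + \<epsilon> * \<Psi> y))"
    using *(2) by linarith
qed

section \<open>The Lyapunov function on the boundary of the level ball\<close>

lemma prob_std_gaussian_inner: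
  fixes e :: "'a::euclidean_space"
  assumes "norm e = 1" "A \<in> sets borel"
  shows "measure std_gaussian {v. e \<bullet> v \<in> A} = measure std_normal A"
proof -
  have "measure std_normal A = measure (distr std_gaussian borel (\<lambda>v. e \<bullet> v)) A"
    using distr_std_gaussian_inner[OF assms(1)] by simp
  also have "\<dots> = measure std_gaussian ((\<lambda>v. e \<bullet> v) -` A \<inter> space std_gaussian)"
    using assms(2) by (intro measure_distr) auto
  finally show ?thesis by (simp add: vimage_def)
qed

lemma obtain_direction:
  fixes u :: "'a::euclidean_space"
  obtains e where "norm e = 1" "e \<bullet> u = norm u"
proof (cases "u = 0")
  case True
  obtain b :: 'a where "b \<in> Basis" using nonempty_Basis by blast
  then show ?thesis using that[of b] True by simp
next
  case False
  have "u \<bullet> u = norm u * norm u" by (simp flip: power2_norm_eq_inner power2_eq_square)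
  then show ?thesis using that[of "u /\<^sub>R norm u"] False by simp
qed

lemma free_flight_norm_ge:
  assumes e: "norm e = 1" "e \<bullet> u = norm u" and "0 \<le> T"
  shows "norm u + T * (e \<bullet> v) \<le> norm (u + T *\<^sub>R v)"
proof -
  have "norm u + T * (e \<bullet> v) = e \<bullet> (u + T *\<^sub>R v)" using e by (simp add: inner_simps)
  also have "\<dots> \<le> norm e * norm (u + T *\<^sub>R v)" by (rule norm_cauchy_schwarz)
  finally show ?thesis using e by simp
qed

lemma near_free_flight_norm_ge:
  assumes "near_free_flight T \<theta> Q"
  shows "norm (u + T *\<^sub>R v) - \<theta> * max (norm u) (norm (u + T *\<^sub>R v)) \<le> norm (Q u v)"
proof -
  have "norm (u + T *\<^sub>R v) \<le> norm (Q u v) + norm (Q u v - (u + T *\<^sub>R v))"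
    by (metis norm_minus_commute norm_triangle_sub)
  then show ?thesis using assms unfolding near_free_flight_def by (smt (verit))
qed

text \<open>A velocity component above \<open>(R - |u|) / T + 1 / 12\<close> takes the free flight beyond the distance
  \<open>R + T / 12\<close> from the origin. The relative error \<open>\<theta>\<close> does not bring it back, since
  \<open>(1 - \<theta>) (R + T / 12) \<ge> R + T / 12 - T / 16 - T / 48 = R\<close>.\<close>

lemma exit_velocity:
  assumes Q: "near_free_flight T \<theta> Q" and T: "0 < T" and \<theta>: "0 \<le> \<theta>" "\<theta> \<le> 1 / 4" "\<theta> * R \<le> T / 16"
    and e: "norm e = 1" "e \<bullet> u = norm u" and u: "norm u \<le> R"
    and v: "(R - norm u) / T + 1 / 12 < e \<bullet> v"
  shows "R < norm (Q u v)"
proof -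
  let ?n = "norm (u + T *\<^sub>R v)"
  have "R - norm u + T / 12 < T * (e \<bullet> v)" using v T by (simp add: field_simps)
  then have n: "R + T / 12 < ?n" using free_flight_norm_ge[OF e, of T v] T by simp
  then have "max (norm u) ?n = ?n" using u T by simp
  then have "(1 - \<theta>) * ?n \<le> norm (Q u v)"
    using near_free_flight_norm_ge[OF Q, of u v] by (simp add: algebra_simps)
  moreover have "(1 - \<theta>) * (R + T / 12) < (1 - \<theta>) * ?n" using n \<theta> by (intro mult_strict_left_mono) auto
  moreover have "R \<le> (1 - \<theta>) * (R + T / 12)"
  proof -
    have "\<theta> * T \<le> 1 / 4 * T" using \<theta> T by (intro mult_right_mono) auto
    then show ?thesis using \<theta>(3) by (simp add: algebra_simps)
  qed
  ultimately show ?thesis by linarith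
qed

text \<open>In free flight the inward distance is at most \<open>5 / 12 T\<close>, and the error adds at most
  \<open>\<theta> R \<le> T / 16\<close>; the sum is \<open>23 / 48 T\<close>.\<close>

lemma shell_velocity:
  assumes Q: "near_free_flight T \<theta> Q" and T: "0 < T" and \<theta>: "0 \<le> \<theta>" "\<theta> \<le> 1 / 4" "\<theta> * R \<le> T / 16"
    and e: "norm e = 1" "e \<bullet> u = norm u" and u: "norm u = R"
    and v: "- 5 / 12 \<le> e \<bullet> v"
  shows "R - 23 / 48 * T \<le> norm (Q u v)"
proof -
  let ?n = "norm (u + T *\<^sub>R v)"
  have "T * (- 5 / 12) \<le> T * (e \<bullet> v)" using v T by (intro mult_left_mono) auto
  then have n: "R - 5 / 12 * T \<le> ?n" using free_flight_norm_ge[OF e, of T v] T u by simp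
  show ?thesis
  proof (cases "?n \<le> R")
    case True
    then show ?thesis using near_free_flight_norm_ge[OF Q, of u v] n \<theta> u by simp
  next
    case False
    then have "(1 - \<theta>) * ?n \<le> norm (Q u v)"
      using near_free_flight_norm_ge[OF Q, of u v] u by (simp add: algebra_simps)
    moreover have "(1 - \<theta>) * R \<le> (1 - \<theta>) * ?n" using False \<theta> by (intro mult_left_mono) auto
    ultimately show ?thesis using \<theta> T by (simp add: algebra_simps)
  qed
qed

text \<open>The points at distance exactly \<open>R\<close> from the origin may belong to the level set, and as \<open>\<Psi>\<close>
  is just measurable, \<open>\<Psi>\<close> could conceivably be tiny there. The drift condition rules this out: from
  the boundary the next step leaves the ball, where \<open>\<Psi>\<close> exceeds \<open>m = 4 \<alpha> / \<lambda>\<close>, with a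
  probability of almost \<open>1 / 2\<close>, so that \<open>\<Psi>\<close> has to be almost \<open>m / 2\<close>. The defect is repaired
  by a second step. In a shell of width \<open>23 / 48 T\<close> inside the ball the exit probability is still at
  least \<open>1 / 4\<close>, hence \<open>\<Psi> \<ge> m / 4\<close> there, and the next step ends in this shell or outside of the
  ball with a velocity component in \<open>(- 5 / 12, 1 / 12]\<close>. The probability of the latter is at least
  \<open>3 / 20\<close>, and \<open>67 / 144 + 3 / 80 > 1 / 2\<close>.\<close>

lemma level_on_boundary:
  fixes \<Psi> :: "'a::euclidean_space \<Rightarrow> real"
  assumes Q: "near_free_flight T \<theta> Q" and T: "0 < T" and \<theta>: "0 \<le> \<theta>" "\<theta> \<le> 1 / 4" "\<theta> * R \<le> T / 16"
    and lam: "0 < lam" and al: "0 < \<alpha>"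
    and \<Psi>0: "\<And>u. 0 \<le> \<Psi> u"
    and int: "\<And>u. integrable std_gaussian (\<lambda>v. \<Psi> (Q u v))"
    and drift: "\<And>u. (\<integral>v. \<Psi> (Q u v) \<partial>std_gaussian) \<le> (1 - lam) * \<Psi> u + \<alpha>"
    and outside: "\<And>u. R < norm u \<Longrightarrow> 4 * \<alpha> / lam < \<Psi> u"
    and x: "norm x = R"
  shows "2 * \<alpha> / lam \<le> \<Psi> x"
proof -
  define m where "m = 4 * \<alpha> / lam"
  have m: "0 < m" "\<alpha> = lam * m / 4" using lam al by (auto simp: m_def)
  interpret N: prob_space "std_gaussian :: 'a measure" by (rule prob_space_std_gaussian)
  have ind: "integrable std_gaussian (\<lambda>v. indicator {v. e \<bullet> v \<in> A} v :: real)"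
    if "A \<in> sets borel" for A :: "real set" and e :: 'a
  proof (rule N.integrable_const_bound[where B = 1])
    have "{v. e \<bullet> v \<in> A} = (\<lambda>v. e \<bullet> v) -` A \<inter> space borel" by auto
    also have "\<dots> \<in> sets borel" using that by (intro measurable_sets[of _ _ borel]) auto
    finally show "(\<lambda>v. indicator {v. e \<bullet> v \<in> A} v :: real) \<in> borel_measurable std_gaussian" by simp
  qed auto
  \<comment> \<open>The mean of \<open>\<Psi>\<close> after one step, estimated from below by the contributions of two ranges of
    the velocity component in the direction \<open>e\<close>.\<close>
  have gain: "m * measure std_normal {b<..} + k * measure std_normal {a<..b} \<le> (1 - lam) * \<Psi> u + \<alpha>"
    if e: "norm e = 1"
      and out: "\<And>v. b < e \<bullet> v \<Longrightarrow> R < norm (Q u v)"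
      and inner: "\<And>v. a < e \<bullet> v \<Longrightarrow> e \<bullet> v \<le> b \<Longrightarrow> k \<le> \<Psi> (Q u v)"
    for e u :: 'a and a b k :: real
  proof -
    have "(\<integral>v. m * indicator {v. e \<bullet> v \<in> {b<..}} v + k * indicator {v. e \<bullet> v \<in> {a<..b}} v \<partial>std_gaussian)
        \<le> (\<integral>v. \<Psi> (Q u v) \<partial>std_gaussian)"
    proof (rule integral_mono)
      fix v
      show "m * indicator {v. e \<bullet> v \<in> {b<..}} v + k * indicator {v. e \<bullet> v \<in> {a<..b}} v \<le> \<Psi> (Q u v)"
        using outside[OF out, of v] inner[of v] \<Psi>0[of "Q u v"]
        by (auto simp: indicator_def m_def)
    qed (intro Bochner_Integration.integrable_add integrable_mult_right ind int; simp)+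
    also have "(\<integral>v. m * indicator {v. e \<bullet> v \<in> {b<..}} v + k * indicator {v. e \<bullet> v \<in> {a<..b}} v \<partial>std_gaussian)
        = m * measure std_normal {b<..} + k * measure std_normal {a<..b}"
      using ind[of "{b<..}" e] ind[of "{a<..b}" e] prob_std_gaussian_inner[OF e, of "{b<..}"]
        prob_std_gaussian_inner[OF e, of "{a<..b}"] by simp
    finally show ?thesis using drift[of u] by linarith
  qed
  obtain ex where ex: "norm ex = 1" "ex \<bullet> x = norm x" by (rule obtain_direction)
  have out_x: "R < norm (Q x v)" if "1 / 12 < ex \<bullet> v" for v
    using exit_velocity[OF Q T \<theta> ex] x that by simp
  \<comment> \<open>From the boundary the exit probability is at least \<open>67 / 144\<close>, which for \<open>\<lambda> \<ge> 1\<close> would force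
    \<open>\<lambda> > 4 / 3\<close>; but then the drift inequality fails at any point outside of the ball.\<close>
  have lam1: "lam < 1"
  proof (rule ccontr)
    assume "\<not> lam < 1"
    then have le: "(1 - lam) * \<Psi> x \<le> 0" using \<Psi>0[of x] by (simp add: mult_nonpos_nonneg)
    have "m * (1 / 2 - 5 / 12 * (1 / 12)) \<le> m * measure std_normal {1 / 12<..}"
      using m by (intro mult_left_mono prob_std_normal_tail_ge) auto
    also have "\<dots> \<le> (1 - lam) * \<Psi> x + \<alpha>"
      using gain[OF ex(1), of "1 / 12" x "1 / 12" 0] out_x by simp
    also have "\<dots> \<le> lam * m / 4" using le m(2) by linarith
    finally have large: "1 / 2 - 5 / 12 * (1 / 12) \<le> lam / 4" using m by (simp add: field_simps)
    obtain b :: 'a where b: "b \<in> Basis" using nonempty_Basis by blast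
    have "0 \<le> R" using x by auto
    then have "m < \<Psi> ((R + 1) *\<^sub>R b)" using outside[of "(R + 1) *\<^sub>R b"] b by (simp add: m_def)
    then have "(1 - lam) * \<Psi> ((R + 1) *\<^sub>R b) \<le> (1 - lam) * m"
      using \<open>\<not> lam < 1\<close> by (intro mult_left_mono_neg) auto
    moreover have "0 \<le> (1 - lam) * \<Psi> ((R + 1) *\<^sub>R b) + \<alpha>"
      using drift[of "(R + 1) *\<^sub>R b"] \<Psi>0 by (smt (verit) Bochner_Integration.integral_nonneg)
    ultimately have "0 \<le> (1 - lam) * m + lam * m / 4" using m(2) by linarith
    then have "0 \<le> m * (1 - 3 / 4 * lam)" by (simp add: algebra_simps)
    then have "lam \<le> 4 / 3" using m by (simp add: zero_le_mult_iff)
    then show False using large by simp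
  qed
  have shell: "m / 4 \<le> \<Psi> u" if u: "R - 23 / 48 * T \<le> norm u" for u
  proof (cases "R < norm u")
    case True
    then show ?thesis using outside[of u] m(1) by (simp add: m_def)
  next
    case False
    obtain e where e: "norm e = 1" "e \<bullet> u = norm u" by (rule obtain_direction)
    have le: "(R - norm u) / T \<le> 23 / 48" using u T by (simp add: field_simps)
    have "R < norm (Q u v)" if "9 / 16 < e \<bullet> v" for v
    proof (rule exit_velocity[OF Q T \<theta> e])
      show "(R - norm u) / T + 1 / 12 < e \<bullet> v" using le that by linarith
    qed (use False in simp)
    then have "m * measure std_normal {9 / 16<..} \<le> (1 - lam) * \<Psi> u + \<alpha>"
      using gain[OF e(1), of "9 / 16" u "9 / 16" 0] by simp
    moreover have "m * (1 / 4) \<le> m * measure std_normal {9 / 16<..}"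
      using m prob_std_normal_tail_ge[of "9 / 16"] by (intro mult_left_mono) auto
    moreover have "m / 4 - \<alpha> = (1 - lam) * (m / 4)" using m(2) by (simp add: algebra_simps)
    ultimately have "(1 - lam) * (m / 4) \<le> (1 - lam) * \<Psi> u" by linarith
    then show ?thesis using lam1 by simp
  qed
  have "m * measure std_normal {1 / 12<..} + m / 4 * measure std_normal {- 5 / 12<..1 / 12}
      \<le> (1 - lam) * \<Psi> x + \<alpha>"
    using gain[OF ex(1), of "1 / 12" x "- 5 / 12" "m / 4"] out_x
      shell[OF shell_velocity[OF Q T \<theta> ex x]] by simp
  moreover have "m * (67 / 144) \<le> m * measure std_normal {1 / 12<..}"
    using m prob_std_normal_tail_ge[of "1 / 12"] by (intro mult_left_mono) auto
  moreover have "m / 4 * (3 / 20) \<le> m / 4 * measure std_normal {- 5 / 12<..1 / 12}"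
    using m prob_std_normal_Ioc_ge[of "- 5 / 12" "1 / 12"] by (intro mult_left_mono) auto
  moreover have "m / 2 \<le> m * (67 / 144) + m / 4 * (3 / 20)" using m by simp
  ultimately have "m / 2 - lam * m / 4 \<le> (1 - lam) * \<Psi> x" using m(2) by linarith
  moreover have "(1 - lam) * (m / 2) = m / 2 - lam * m / 4 - lam * m / 4" by (simp add: field_simps)
  moreover have "0 < lam * m" using lam m(1) by simp
  ultimately have "(1 - lam) * (m / 2) \<le> (1 - lam) * \<Psi> x" by linarith
  then have "m / 2 \<le> \<Psi> x" using lam1 by simp
  then show ?thesis by (simp add: m_def)
qed

text \<open>Otherwise a point at which \<open>\<Psi>\<close> is within \<open>\<alpha>\<close> of its infimum would have a mean value after
  one step below the infimum, since the drift lowers \<open>\<Psi>\<close> by more than \<open>3 \<alpha>\<close>.\<close>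

lemma drift_small_level_nonempty:
  fixes \<Psi> :: "'a::euclidean_space \<Rightarrow> real" and Q :: "'a \<Rightarrow> 'a \<Rightarrow> 'a"
  assumes lam: "0 < lam" and al: "0 < \<alpha>"
    and \<Psi>0: "\<And>u. 0 \<le> \<Psi> u"
    and int: "\<And>u. integrable std_gaussian (\<lambda>v. \<Psi> (Q u v))"
    and drift: "\<And>u. (\<integral>v. \<Psi> (Q u v) \<partial>std_gaussian) \<le> (1 - lam) * \<Psi> u + \<alpha>"
  obtains u where "\<Psi> u \<le> 4 * \<alpha> / lam"
proof (rule ccontr)
  assume "\<not> thesis"
  then have big: "4 * \<alpha> / lam < \<Psi> u" for u using that[of u] by linarith
  interpret N: prob_space "std_gaussian :: 'a measure" by (rule prob_space_std_gaussian)
  define I where "I = (INF u. \<Psi> u)"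
  have bdd: "bdd_below (range \<Psi>)" using \<Psi>0 by (intro bdd_belowI2) auto
  have I: "I \<le> \<Psi> u" for u unfolding I_def by (rule cINF_lower[OF bdd]) simp
  obtain u where u: "\<Psi> u < I + \<alpha>"
    using cINF_less_iff[of UNIV \<Psi> "I + \<alpha>"] bdd al by (auto simp: I_def)
  have "I = (\<integral>v. I \<partial>(std_gaussian :: 'a measure))" using N.prob_space by simp
  also have "\<dots> \<le> (\<integral>v. \<Psi> (Q u v) \<partial>std_gaussian)"
    using I by (intro integral_mono[OF _ int]) auto
  also have "\<dots> \<le> (1 - lam) * \<Psi> u + \<alpha>" by (rule drift)
  also have "\<dots> = \<Psi> u - lam * \<Psi> u + \<alpha>" by (simp add: algebra_simps)
  also have "\<dots> < I" using big[of u] u lam al by (simp add: field_simps)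
  finally show False by simp
qed

section \<open>Contraction of the coupled transition step\<close>

lemma (in prob_space) distr_pair_indep_set:
  assumes X [measurable]: "X \<in> borel_measurable M" and Y [measurable]: "Y \<in> borel_measurable M"
    and indep: "indep_set {X -` A \<inter> space M | A. A \<in> sets borel} {Y -` B \<inter> space M | B. B \<in> sets borel}"
  shows "distr M borel X \<Otimes>\<^sub>M distr M borel Y = distr M (borel \<Otimes>\<^sub>M borel) (\<lambda>\<omega>. (X \<omega>, Y \<omega>))"
proof (rule pair_measure_eqI)
  interpret X: prob_space "distr M borel X" by (rule prob_space_distr[OF X])
  interpret Y: prob_space "distr M borel Y" by (rule prob_space_distr[OF Y])
  show "sigma_finite_measure (distr M borel X)" "sigma_finite_measure (distr M borel Y)"
    by unfold_locales
  fix A B assume "A \<in> sets (distr M borel X)" "B \<in> sets (distr M borel Y)"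
  then have [measurable]: "A \<in> sets borel" "B \<in> sets borel" by simp_all
  have "prob ((X -` A \<inter> space M) \<inter> (Y -` B \<inter> space M)) = prob (X -` A \<inter> space M) * prob (Y -` B \<inter> space M)"
    by (rule indep_setD[OF indep]) auto
  moreover have "(\<lambda>\<omega>. (X \<omega>, Y \<omega>)) -` (A \<times> B) \<inter> space M = (X -` A \<inter> space M) \<inter> (Y -` B \<inter> space M)"
    by auto
  ultimately show "emeasure (distr M borel X) A * emeasure (distr M borel Y) B
      = emeasure (distr M (borel \<Otimes>\<^sub>M borel) (\<lambda>\<omega>. (X \<omega>, Y \<omega>))) (A \<times> B)"
    by (simp add: emeasure_distr emeasure_eq_measure ennreal_mult)
qed simp

lemma step_size_quarter:
  fixes L T h1 :: real
  assumes L: "0 \<le> L" and T: "0 < T" and h1: "0 < h1" and step: "L * (T + h1)\<^sup>2 \<le> 1 / 4"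
  shows "L * (T * (T + h1)) \<le> 1 / 4"
proof -
  have "L * (T * (T + h1)) \<le> L * (T + h1)\<^sup>2"
    using L T h1 unfolding power2_eq_square by (intro mult_left_mono mult_right_mono) auto
  then show ?thesis using step by simp
qed

text \<open>For \<open>L > 0\<close> the hypothesis says \<open>(16 L R (T + h\<^sub>1))\<^sup>2 \<le> 1\<close>.\<close>

lemma step_size_radius:
  fixes L T h1 R :: real
  assumes L: "0 \<le> L" and T: "0 < T" and R: "0 < R"
    and step: "L * (T + h1)\<^sup>2 \<le> 1 / (256 * L * R\<^sup>2)"
  shows "L * (T * (T + h1)) * R \<le> T / 16"
proof (cases "L = 0")
  case True
  then show ?thesis using T by simp
next
  case False
  then have "(16 * L * R * (T + h1))\<^sup>2 \<le> 1"
    using step L R by (simp add: field_simps power2_eq_square)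
  then have "16 * L * R * (T + h1) \<le> 1" using power2_le_imp_le[of _ "1::real"] by simp
  then have "T * (16 * L * R * (T + h1)) \<le> T * 1" using T by (intro mult_left_mono) auto
  then show ?thesis by (simp add: algebra_simps)
qed

lemma coupled_velocity_mirror:
  assumes "norm (x - y) < 2 * R" "x \<noteq> y"
  shows "coupled_velocity R \<gamma> x y v u
    = mirror_velocity ((x - y) /\<^sub>R norm (x - y)) (\<gamma> * norm (x - y)) v u"
  using assms by (simp add: coupled_velocity_def mirror_velocity_def density_ratio_def reflection_def Let_def)

text \<open>In free flight the velocity shift \<open>\<gamma> (x - y)\<close> shrinks the separation to
  \<open>(1 - \<gamma> T) (x - y)\<close>, and the deviation consumes at most a quarter of this gain.\<close>

lemma translated_contracts:
  assumes Q: "near_free_flight T \<theta> Q" and "0 \<le> \<gamma> * T" "\<gamma> * T \<le> 1" and \<theta>: "0 \<le> \<theta>" "\<theta> \<le> \<gamma> * T / 4"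
  shows "norm (Q x v - Q y (v + \<gamma> *\<^sub>R (x - y))) \<le> (1 - 3 / 4 * (\<gamma> * T)) * norm (x - y)"
proof -
  let ?z = "x - y"
  let ?d = "?z + T *\<^sub>R (v - (v + \<gamma> *\<^sub>R ?z))"
  have "?d = (1 - \<gamma> * T) *\<^sub>R ?z" by (simp add: algebra_simps)
  then have d: "norm ?d = (1 - \<gamma> * T) * norm ?z" using assms by simp
  also have "\<dots> \<le> norm ?z" using assms by (intro mult_left_le_one_le) auto
  finally have "max (norm ?z) (norm ?d) = norm ?z" by simp
  then have "norm ((Q x v - Q y (v + \<gamma> *\<^sub>R ?z)) - ?d) \<le> \<theta> * norm ?z"
    using Q unfolding near_free_flight_def by metis
  moreover have "\<theta> * norm ?z \<le> \<gamma> * T / 4 * norm ?z" using \<theta> by (intro mult_right_mono) auto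
  moreover have "norm (Q x v - Q y (v + \<gamma> *\<^sub>R ?z)) \<le> norm ?d + norm ((Q x v - Q y (v + \<gamma> *\<^sub>R ?z)) - ?d)"
    by (metis add.commute diff_add_cancel norm_triangle_ineq)
  ultimately show ?thesis using d by (simp add: algebra_simps)
qed

theorem theorem2p6:
  fixes U \<Psi> :: "'a::euclidean_space \<Rightarrow> real"
    and q p :: "real \<Rightarrow> 'a \<Rightarrow> 'a \<Rightarrow> 'a"
    and T h1 L lam \<alpha> R \<gamma> a R1 \<epsilon> c :: real
    and M :: "'w measure" and \<xi> :: "'w \<Rightarrow> 'a" and V :: "'w \<Rightarrow> real"
  assumes U_C4: "C4_map U"
    and U_int: "integrable lborel (\<lambda>x. exp (- U x))"
    and A1: "\<forall>\<^sub>F x in nhds 0. U 0 \<le> U x" "U 0 = 0"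
    and A2: "bounded (range (fderiv (fderiv U)))"
            "bounded (range (fderiv (fderiv (fderiv U))))"
            "bounded (range (fderiv (fderiv (fderiv (fderiv U)))))"
    and L: "L = (SUP x. norm (fderiv (fderiv U) x))"
    and T_pos: "0 < T" and h1_pos: "0 < h1"
    and flow: "exact_flow U q p \<or>
               (\<exists>h. 0 < h \<and> h \<le> h1 \<and> T / h \<in> \<int> \<and> verlet_flow U h q p)"
    and Psi: "\<Psi> \<in> borel_measurable borel" "\<And>x. 0 \<le> \<Psi> x"
    and lam_alpha_pos: "0 < lam" "0 < \<alpha>"
    and A4: "compact {x. \<Psi> x \<le> 4 * \<alpha> / lam}"
    and A5: "\<And>x. integrable (hmc_kernel q T x) \<Psi> \<and>
                 (\<integral>y. \<Psi> y \<partial>hmc_kernel q T x) \<le> (1 - lam) * \<Psi> x + \<alpha>"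
    and R: "R = Sup {norm x | x. \<Psi> x \<le> 4 * \<alpha> / lam}"
    and step: "L * (T + h1)\<^sup>2 \<le> (if R = 0 then 1 / 4 else min (1 / 4) (1 / (256 * L * R\<^sup>2)))"
    and gamma: "\<gamma> = (if R = 0 then 1 / T else min (1 / T) (1 / R / 4))"
    and a: "a = 1 / T"
    and R1: "R1 = 5 / 2 * (R + T)"
    and eps: "\<epsilon> = 1 / (40 * \<alpha>) * exp (- 2 * R / T)"
    and c: "c = 1 / 80 * min (10 * lam) (exp (- 2 * R / T))"
    and M: "prob_space M"
    and rv: "\<xi> \<in> borel_measurable M" "V \<in> borel_measurable M"
    and indep: "prob_space.indep_set M {\<xi> -` A \<inter> space M | A. A \<in> sets borel}
                                       {V -` B \<inter> space M | B. B \<in> sets borel}"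
    and xi: "distr M borel \<xi> = std_gaussian"
    and V: "distr M borel V = uniform_measure lborel {0..1}"
  shows "\<forall>x y.
      integrable M (\<lambda>\<omega>. rho a R1 R \<epsilon> \<Psi>
        (q T x (\<xi> \<omega>)) (q T y (coupled_velocity R \<gamma> x y (\<xi> \<omega>) (V \<omega>)))) \<and>
      (\<integral>\<omega>. rho a R1 R \<epsilon> \<Psi>
        (q T x (\<xi> \<omega>)) (q T y (coupled_velocity R \<gamma> x y (\<xi> \<omega>) (V \<omega>))) \<partial>M)
      \<le> (1 - c) * rho a R1 R \<epsilon> \<Psi> x y"
proof -
  interpret M: prob_space M by (rule M)
  let ?\<theta> = "L * (T * (T + h1))"
  have U: "C1_map U" "C1_map (fderiv U)" using U_C4 by (auto simp: C4_map_def)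
  have "bdd_above (range (\<lambda>x. norm (fderiv (fderiv U) x)))"
    using A2(1) unfolding bounded_iff by (meson bdd_aboveI2 rangeI)
  then have hess: "norm (fderiv (fderiv U) x) \<le> L" for x unfolding L by (intro cSUP_upper) auto
  then have L0: "0 \<le> L" using norm_ge_zero order_trans by blast
  have \<theta>4: "?\<theta> \<le> 1 / 4"
    using step by (intro step_size_quarter[OF L0 T_pos h1_pos]) (auto split: if_splits)
  have \<theta>0: "0 \<le> ?\<theta>" using L0 T_pos h1_pos by simp
  have Q: "near_free_flight T ?\<theta> (q T)"
    using \<theta>4 by (intro hmc_near_free_flight[OF grad_lipschitz[OF U hess] L0 grad_local_min[OF U(1) A1(1)]
        T_pos h1_pos _ flow]) auto
  have T0: "0 \<le> T" using T_pos by simp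
  have meas [measurable]: "q T x \<in> borel_measurable borel" for x
    by (rule near_free_flight_measurable[OF Q T0 \<theta>0])
  have [measurable]: "\<Psi> \<in> borel_measurable borel" by (rule Psi)
  have int: "integrable std_gaussian (\<lambda>v. \<Psi> (q T u v))"
    and drift: "(\<integral>v. \<Psi> (q T u v) \<partial>std_gaussian) \<le> (1 - lam) * \<Psi> u + \<alpha>" for u
    using A5[of u] by (simp_all add: hmc_kernel_def integrable_distr_eq integral_distr)
  obtain u0 where u0: "\<Psi> u0 \<le> 4 * \<alpha> / lam"
    by (rule drift_small_level_nonempty[OF lam_alpha_pos Psi(2) int drift])
  have bdd: "bdd_above {norm x | x. \<Psi> x \<le> 4 * \<alpha> / lam}"
    using compact_imp_bounded[OF A4] unfolding bounded_iff bdd_above_def by blast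
  have level_norm: "norm x \<le> R" if "\<Psi> x \<le> 4 * \<alpha> / lam" for x
    unfolding R using that by (intro cSup_upper bdd) auto
  have R0: "0 \<le> R" using level_norm[OF u0] norm_ge_zero order_trans by blast
  have outside: "4 * \<alpha> / lam < \<Psi> u" if "R < norm u" for u
    using level_norm[of u] that by force
  have rho_eq: "rho a R1 R \<epsilon> \<Psi> x y
      = sqrt (saturating T (min (norm (x - y)) (2 * R)) * (1 + \<epsilon> * \<Psi> x + \<epsilon> * \<Psi> y))" for x y
    unfolding a using T_pos R0 by (intro rho_eq_saturating) (auto simp: R1)
  show ?thesis
  proof (intro allI)
    fix x y
    define \<eta> where "\<eta> \<omega> = coupled_velocity R \<gamma> x y (\<xi> \<omega>) (V \<omega>)" for \<omega>
    define X where "X \<omega> = q T x (\<xi> \<omega>)" for \<omega>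
    define Y where "Y \<omega> = q T y (\<eta> \<omega>)" for \<omega>
    have "integrable M (\<lambda>\<omega>. rho a R1 R \<epsilon> \<Psi> (X \<omega>) (Y \<omega>)) \<and>
      (\<integral>\<omega>. rho a R1 R \<epsilon> \<Psi> (X \<omega>) (Y \<omega>) \<partial>M) \<le> (1 - c) * rho a R1 R \<epsilon> \<Psi> x y"
    \<comment> \<open>In these two cases both sides vanish.\<close>
    proof (cases "R = 0 \<or> x = y")
      case True
      have "rho a R1 R \<epsilon> \<Psi> (X \<omega>) (Y \<omega>) = 0" for \<omega>
      proof (cases "R = 0")
        case False
        then have "x = y" using True by simp
        then have "X \<omega> = Y \<omega>" by (simp add: X_def Y_def \<eta>_def coupled_velocity_def)
        then show ?thesis using R0 by (simp add: rho_eq saturating_def)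
      qed (subst rho_eq, simp add: saturating_def)
      moreover have "rho a R1 R \<epsilon> \<Psi> x y = 0" using True R0 by (auto simp: rho_eq saturating_def)
      ultimately show ?thesis by simp
    next
      case False
      then have Rpos: "0 < R" and "x \<noteq> y" using R0 by auto
      have \<theta>R: "?\<theta> * R \<le> T / 16"
        using step Rpos by (intro step_size_radius[OF L0 T_pos Rpos]) auto
      have \<gamma>: "\<gamma> = min (1 / T) (1 / R / 4)" using gamma Rpos by simp
      let ?r = "norm (x - y)" and ?e = "(x - y) /\<^sub>R norm (x - y)"
      have r: "0 < ?r" "norm ?e = 1" using \<open>x \<noteq> y\<close> by auto
      have joint: "distr M (borel \<Otimes>\<^sub>M borel) (\<lambda>\<omega>. (\<xi> \<omega>, V \<omega>)) = std_gaussian \<Otimes>\<^sub>M uniform01"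
        using M.distr_pair_indep_set[OF rv indep] unfolding xi V by (simp add: uniform01_def)
      note [measurable] = rv
      have \<eta>_mirror: "\<eta> \<omega> = mirror_velocity ?e (\<gamma> * ?r) (\<xi> \<omega>) (V \<omega>)" if "?r < 2 * R" for \<omega>
        using coupled_velocity_mirror[OF that \<open>x \<noteq> y\<close>] by (simp add: \<eta>_def)
      have \<eta>_law: "\<eta> \<in> borel_measurable M \<and> distr M borel \<eta> = std_gaussian"
      proof (cases "?r < 2 * R")
        case True
        let ?m = "\<lambda>x. mirror_velocity ?e (\<gamma> * ?r) (fst x) (snd x)"
        have eq: "\<eta> = (\<lambda>\<omega>. ?m (\<xi> \<omega>, V \<omega>))" using \<eta>_mirror[OF True] by auto
        have meas_\<eta>: "\<eta> \<in> borel_measurable M" unfolding eq by measurable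
        have "distr M borel \<eta> = distr (distr M (borel \<Otimes>\<^sub>M borel) (\<lambda>\<omega>. (\<xi> \<omega>, V \<omega>))) borel ?m"
          unfolding eq by (subst distr_distr) (auto simp: comp_def)
        also have "\<dots> = std_gaussian" unfolding joint by (rule distr_mirror_velocity[OF r(2)])
        finally show ?thesis using meas_\<eta> by simp
      next
        case False
        then have "\<eta> = \<xi>" by (auto simp: \<eta>_def coupled_velocity_def)
        then show ?thesis using xi rv by simp
      qed
      then have [measurable]: "\<eta> \<in> borel_measurable M" by simp
      have XY [measurable]: "X \<in> borel_measurable M" "Y \<in> borel_measurable M"
        unfolding X_def Y_def by measurable
      have drift_M: "integrable M (\<lambda>\<omega>. \<Psi> (q T u (\<zeta> \<omega>))) \<and>
          M.expectation (\<lambda>\<omega>. \<Psi> (q T u (\<zeta> \<omega>))) \<le> (1 - lam) * \<Psi> u + \<alpha>"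
        if "\<zeta> \<in> borel_measurable M" "distr M borel \<zeta> = std_gaussian" for u \<zeta>
        using int[of u] drift[of u] that(1) unfolding that(2)[symmetric]
        by (simp add: integrable_distr_eq integral_distr)
      have boundary: "2 * \<alpha> / lam \<le> \<Psi> u" if "norm u = R" for u
        by (rule level_on_boundary[OF Q T_pos \<theta>0 \<theta>4 \<theta>R lam_alpha_pos Psi(2) int drift outside that])
      \<comment> \<open>The only pairs at distance \<open>2 R\<close> or more inside the closed ball are antipodal pairs on its
        boundary, for which the two values \<open>2 \<alpha> / \<lambda>\<close> add up.\<close>
      have far: "4 * \<alpha> / lam \<le> \<Psi> x + \<Psi> y" if "2 * R \<le> ?r"
      proof (cases "R < norm x \<or> R < norm y")
        case True
        then show ?thesis using outside[of x] outside[of y] Psi(2)[of x] Psi(2)[of y] by force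
      next
        case False
        then have "norm x = R" "norm y = R" using that norm_triangle_ineq4[of x y] by auto
        then show ?thesis using boundary[of x] boundary[of y] by simp
      qed
      have near: "M.expectation (\<lambda>\<omega>. saturating T (min (norm (X \<omega> - Y \<omega>)) (2 * R)))
          \<le> (1 - 3 / 40 * exp (- 2 * R / T)) * saturating T ?r" if "?r < 2 * R"
      proof (rule M.expectation_saturating_le[OF T_pos r(1) that \<gamma>])
        let ?B = "{x. \<not> snd x \<le> density_ratio ?e (\<gamma> * ?r) (fst x)}"
        let ?A = "(\<lambda>\<omega>. (\<xi> \<omega>, V \<omega>)) -` ?B \<inter> space M"
        have \<gamma>0: "0 < \<gamma>" "\<gamma> * T \<le> 1" "?\<theta> \<le> \<gamma> * T / 4"
        proof -
          show "0 < \<gamma>" using T_pos Rpos by (simp add: \<gamma>)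
          have "\<gamma> * T \<le> 1 / T * T" unfolding \<gamma> using T_pos by (intro mult_right_mono) auto
          then show "\<gamma> * T \<le> 1" using T_pos by simp
          have "?\<theta> \<le> T / (16 * R)" using \<theta>R Rpos by (simp add: field_simps)
          then show "?\<theta> \<le> \<gamma> * T / 4"
            using \<theta>4 T_pos by (cases "1 / T \<le> 1 / R / 4") (simp_all add: \<gamma> min_def)
        qed
        have B: "?B \<in> sets (borel \<Otimes>\<^sub>M borel)"
        proof -
          have "Measurable.pred (borel \<Otimes>\<^sub>M borel) (\<lambda>x. \<not> snd x \<le> density_ratio ?e (\<gamma> * ?r) (fst x))"
            by measurable
          then show ?thesis by (simp add: pred_def space_pair_measure)
        qed
        show "?A \<in> M.events" using B by (intro measurable_sets[of _ _ "borel \<Otimes>\<^sub>M borel"]) auto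
        have "emeasure M ?A = emeasure (distr M (borel \<Otimes>\<^sub>M borel) (\<lambda>\<omega>. (\<xi> \<omega>, V \<omega>))) ?B"
          using B by (simp add: emeasure_distr)
        also have "\<dots> \<le> ennreal (5 / 12 * (\<gamma> * ?r))"
          unfolding joint using \<gamma>0 by (intro reflection_probability_le r) auto
        finally show "M.prob ?A \<le> 5 / 12 * (\<gamma> * ?r)"
          using \<gamma>0 by (simp add: M.emeasure_eq_measure)
        fix \<omega> assume "\<omega> \<in> space M" "\<omega> \<notin> ?A"
        then have "V \<omega> \<le> density_ratio ?e (\<gamma> * ?r) (\<xi> \<omega>)" by simp
        then have "\<eta> \<omega> = \<xi> \<omega> + \<gamma> *\<^sub>R (x - y)"
          using \<open>x \<noteq> y\<close> by (simp add: \<eta>_mirror[OF that] mirror_velocity_def)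
        then show "norm (X \<omega> - Y \<omega>) \<le> (1 - 3 / 4 * (\<gamma> * T)) * ?r"
          using translated_contracts[OF Q _ \<gamma>0(2) \<theta>0 \<gamma>0(3), of x "\<xi> \<omega>" y] \<gamma>0(1) T_pos
          by (simp add: X_def Y_def)
      qed auto
      note drift_X = drift_M[OF rv(1) xi, of x, folded X_def]
      note drift_Y = drift_M[OF conjunct1[OF \<eta>_law] conjunct2[OF \<eta>_law], of y, folded Y_def]
      note * = M.semimetric_contraction[OF T_pos Rpos lam_alpha_pos eps c XY Psi(2)
          conjunct1[OF drift_X] conjunct2[OF drift_X] conjunct1[OF drift_Y] conjunct2[OF drift_Y]
          \<open>x \<noteq> y\<close> far near]
      show ?thesis unfolding rho_eq using * by simp
    qed
    then show "integrable M (\<lambda>\<omega>. rho a R1 R \<epsilon> \<Psi>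
        (q T x (\<xi> \<omega>)) (q T y (coupled_velocity R \<gamma> x y (\<xi> \<omega>) (V \<omega>)))) \<and>
      (\<integral>\<omega>. rho a R1 R \<epsilon> \<Psi>
        (q T x (\<xi> \<omega>)) (q T y (coupled_velocity R \<gamma> x y (\<xi> \<omega>) (V \<omega>))) \<partial>M)
      \<le> (1 - c) * rho a R1 R \<epsilon> \<Psi> x y"
      by (simp add: X_def Y_def \<eta>_def)
  qed
qed

end
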